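(* Let $k$ be a field, $n\ge2$, $\rho\colon F_n\rtimes B_n\to\mathrm{GL}(V)$ a representation on an $N$-dimensional $k$-vector space, $g_j=\rho(x_j)$, $s_i=\rho(\sigma_i)$, $\lambda\in k^\times\setminus\{1\}$, $1\le i\le n-1$, $S_i:=\rho^{\mathrm{LM}}_\lambda(\sigma_i)$, $W_j:=\mathrm{Ker}(g_j-I)$ for $1\le j\le n$, and $K=\bigoplus_jW_j\subseteq V^{\oplus n}$. The operator $s_i$ preserves $W_k$ for $k\ne i,i+1$ and maps $W_i$ isomorphically onto $W_{i+1}$, while $s_ig_i$ maps $W_{i+1}$ into $W_i$. With respect to $K=\bigoplus_jW_j$, $$S_i|_K=\bigoplus_{k\ne i,i+1}s_i|_{W_k}\;\oplus\;P_i,\qquad P_i(w_i,w_{i+1}):=\bigl(s_ig_i\,w_{i+1},\;s_i\,w_i\bigr)\ \text{ on }W_i\oplus W_{i+1},$$ and the characteristic polynomial of $P_i$ is $$\chi_{P_i}(z)=\det\bigl(z^2I_{W_i}-(s_ig_is_i)|_{W_i}\bigr).$$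
   Context: $B_n$ is the Artin braid group with standard generators $\sigma_1,\dots,\sigma_{n-1}$; $F_n$ is the free group on $x_1,\dots,x_n$. The Artin action $\theta\colon B_n\to\mathrm{Aut}(F_n)$ is $\theta_{\sigma_i}(x_i)=x_{i+1}$, $\theta_{\sigma_i}(x_{i+1})=x_{i+1}^{-1}x_ix_{i+1}$, $\theta_{\sigma_i}(x_j)=x_j$ for $j\ne i,i+1$. $F_n\rtimes B_n$ is the corresponding semidirect product, in which $\sigma x\sigma^{-1}=\theta_\sigma(x)$. Twisted Long--Moody construction: for $\lambda\in k^\times$, $\rho^{\mathrm{LM}}_\lambda\colon F_n\rtimes B_n\to\mathrm{GL}(V^{\oplus n})$ is a representation whose value on braid generators is, in $n\times n$ block form with $N\times N$ blocks, $\rho^{\mathrm{LM}}_\lambda(\sigma_i)=s_i^{\oplus n}\cdot\mathrm{diag}(I_{N(i-1)},R_i,I_{N(n-i-1)})$ with $R_i=\begin{pmatrix}O&g_i\\ I_N&I_N-g_{i+1}\end{pmatrix}$ in block rows and columns $i,i+1$ (and $\rho^{\mathrm{LM}}_\lambda(x_i)$ is the identity except in the $i$-th block row, which equals $(\lambda(g_1-1),\dots,\lambda(g_{i-1}-1),\lambda g_i,g_{i+1}-1,\dots,g_n-1)$). $\chi_A(z):=\det(zI-A)$. *)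

theory Defs
  imports
    "HOL-Algebra.Bij"
    "HOL-Library.Function_Algebras"
    "HOL-Library.Product_Plus"
    "Jordan_Normal_Form.Char_Poly"
begin

section \<open>Groups presented by generators and relations\<close>

text \<open>The letter \<open>(x, True)\<close> stands for the generator \<open>x\<close>, the letter \<open>(x, False)\<close> for its inverse.\<close>

type_synonym 'a word = "('a \<times> bool) list"

definition words :: "'a set \<Rightarrow> 'a word set" where
  "words X = lists (X \<times> UNIV)"

inductive pres_eq :: "'a set \<Rightarrow> ('a word \<times> 'a word) set \<Rightarrow> 'a word \<Rightarrow> 'a word \<Rightarrow> bool"
  for X R where
  refl: "u \<in> words X \<Longrightarrow> pres_eq X R u u"
| sym: "pres_eq X R u v \<Longrightarrow> pres_eq X R v u"
| trans: "pres_eq X R u v \<Longrightarrow> pres_eq X R v w \<Longrightarrow> pres_eq X R u w"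
| cancel: "u \<in> words X \<Longrightarrow> v \<in> words X \<Longrightarrow> x \<in> X \<Longrightarrow>
    pres_eq X R (u @ [(x, e), (x, \<not> e)] @ v) (u @ v)"
| rel: "u \<in> words X \<Longrightarrow> v \<in> words X \<Longrightarrow> (r, s) \<in> R \<Longrightarrow> r \<in> words X \<Longrightarrow> s \<in> words X \<Longrightarrow>
    pres_eq X R (u @ r @ v) (u @ s @ v)"

definition pres_rel :: "'a set \<Rightarrow> ('a word \<times> 'a word) set \<Rightarrow> ('a word \<times> 'a word) set" where
  "pres_rel X R = {(u, v). pres_eq X R u v}"

definition pres_group :: "'a set \<Rightarrow> ('a word \<times> 'a word) set \<Rightarrow> 'a word set monoid" where
  "pres_group X R =
    \<lparr>carrier = words X // pres_rel X R,
     monoid.mult = (\<lambda>A B. \<Union>u\<in>A. \<Union>v\<in>B. pres_rel X R `` {u @ v}),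
     monoid.one = pres_rel X R `` {[]}\<rparr>"

definition pres_gen :: "'a set \<Rightarrow> ('a word \<times> 'a word) set \<Rightarrow> 'a \<Rightarrow> 'a word set" where
  "pres_gen X R x = pres_rel X R `` {[(x, True)]}"

definition word_eval :: "('b, 'm) monoid_scheme \<Rightarrow> ('a \<Rightarrow> 'b) \<Rightarrow> 'a word \<Rightarrow> 'b" where
  "word_eval H f w =
    foldr (\<lambda>(x, e) h. (if e then f x else inv\<^bsub>H\<^esub> (f x)) \<otimes>\<^bsub>H\<^esub> h) w \<one>\<^bsub>H\<^esub>"

text \<open>The homomorphism out of a presented group with prescribed values \<open>f\<close> on the generators.
  It is meaningful only if these values lie in \<open>H\<close> and satisfy the relations, so that evaluation
  is constant on each class of words.\<close>

definition pres_lift ::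
    "'a set \<Rightarrow> ('a word \<times> 'a word) set \<Rightarrow> ('b, 'm) monoid_scheme \<Rightarrow> ('a \<Rightarrow> 'b) \<Rightarrow> 'a word set \<Rightarrow> 'b" where
  "pres_lift X R H f = (\<lambda>A \<in> carrier (pres_group X R). the_elem (word_eval H f ` A))"

section \<open>Free groups, braid groups and the Artin action\<close>

abbreviation free_grp :: "nat \<Rightarrow> nat word set monoid" where
  "free_grp n \<equiv> pres_group {1..n} {}"

abbreviation free_gen :: "nat \<Rightarrow> nat \<Rightarrow> nat word set" where
  "free_gen n \<equiv> pres_gen {1..n} {}"

definition braid_rels :: "nat \<Rightarrow> (nat word \<times> nat word) set" where
  "braid_rels n =
    {([(i, True), (j, True)], [(j, True), (i, True)]) | i j.
        i \<in> {1..n - 1} \<and> j \<in> {1..n - 1} \<and> i + 2 \<le> j} \<union>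
    {([(i, True), (i + 1, True), (i, True)], [(i + 1, True), (i, True), (i + 1, True)]) | i.
        i \<in> {1..n - 1} \<and> i + 1 \<in> {1..n - 1}}"

abbreviation braid_grp :: "nat \<Rightarrow> nat word set monoid" where
  "braid_grp n \<equiv> pres_group {1..n - 1} (braid_rels n)"

abbreviation braid_gen :: "nat \<Rightarrow> nat \<Rightarrow> nat word set" where
  "braid_gen n \<equiv> pres_gen {1..n - 1} (braid_rels n)"

definition artin_gen :: "nat \<Rightarrow> nat \<Rightarrow> nat word set \<Rightarrow> nat word set" where
  "artin_gen n i = pres_lift {1..n} {} (free_grp n) (\<lambda>j.
     if j = i then free_gen n (i + 1)
     else if j = i + 1 then
       inv\<^bsub>free_grp n\<^esub> (free_gen n (i + 1)) \<otimes>\<^bsub>free_grp n\<^esub> free_gen n i \<otimes>\<^bsub>free_grp n\<^esub> free_gen n (i + 1)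
     else free_gen n j)"

definition artin :: "nat \<Rightarrow> nat word set \<Rightarrow> nat word set \<Rightarrow> nat word set" where
  "artin n = pres_lift {1..n - 1} (braid_rels n) (AutoGroup (free_grp n)) (artin_gen n)"

text \<open>In the semidirect product below, \<open>(\<one>, b) (x, \<one>) (\<one>, b)\<inverse> = (\<theta> b x, \<one>)\<close>.\<close>

definition semidirect ::
    "('a, 'm) monoid_scheme \<Rightarrow> ('b, 'l) monoid_scheme \<Rightarrow> ('b \<Rightarrow> 'a \<Rightarrow> 'a) \<Rightarrow> ('a \<times> 'b) monoid" where
  "semidirect G H \<theta> =
    \<lparr>carrier = carrier G \<times> carrier H,
     monoid.mult = (\<lambda>(x, a) (y, b). (x \<otimes>\<^bsub>G\<^esub> \<theta> a y, a \<otimes>\<^bsub>H\<^esub> b)),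
     monoid.one = (\<one>\<^bsub>G\<^esub>, \<one>\<^bsub>H\<^esub>)\<rparr>"

type_synonym free_braid_elt = "nat word set \<times> nat word set"

definition free_braid_grp :: "nat \<Rightarrow> free_braid_elt monoid" where
  "free_braid_grp n = semidirect (free_grp n) (braid_grp n) (artin n)"

definition fb_x :: "nat \<Rightarrow> nat \<Rightarrow> free_braid_elt" where
  "fb_x n j = (free_gen n j, \<one>\<^bsub>braid_grp n\<^esub>)"

definition fb_sigma :: "nat \<Rightarrow> nat \<Rightarrow> free_braid_elt" where
  "fb_sigma n i = (\<one>\<^bsub>free_grp n\<^esub>, braid_gen n i)"

section \<open>Linear algebra\<close>

definition linear_on ::
    "('k \<Rightarrow> 'v::ab_group_add \<Rightarrow> 'v) \<Rightarrow> 'v set \<Rightarrow> ('v \<Rightarrow> 'v) \<Rightarrow> bool" where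
  "linear_on scale U f \<longleftrightarrow>
    (\<forall>u\<in>U. \<forall>v\<in>U. f (u + v) = f u + f v) \<and> (\<forall>c. \<forall>v\<in>U. f (scale c v) = scale c (f v))"

text \<open>\<open>GL(U)\<close> for a subspace \<open>U\<close> of the ambient type; as in \<^const>\<open>AutoGroup\<close>, its elements are
  \<open>undefined\<close> outside \<open>U\<close>, which is no restriction for \<open>U = UNIV\<close>.\<close>

definition GL_on :: "('k \<Rightarrow> 'v::ab_group_add \<Rightarrow> 'v) \<Rightarrow> 'v set \<Rightarrow> ('v \<Rightarrow> 'v) monoid" where
  "GL_on scale U = BijGroup U \<lparr>carrier := {f \<in> Bij U. linear_on scale U f}\<rparr>"

definition fun_scale :: "('k \<Rightarrow> 'v \<Rightarrow> 'v) \<Rightarrow> 'k \<Rightarrow> (nat \<Rightarrow> 'v) \<Rightarrow> nat \<Rightarrow> 'v" where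
  "fun_scale scale c v = (\<lambda>j. scale c (v j))"

definition pair_scale :: "('k \<Rightarrow> 'v \<Rightarrow> 'v) \<Rightarrow> 'k \<Rightarrow> 'v \<times> 'v \<Rightarrow> 'v \<times> 'v" where
  "pair_scale scale c p = (scale c (fst p), scale c (snd p))"

text \<open>The direct sum of \<open>W 1, ..., W n\<close>; tuples are padded with \<open>0\<close> outside \<open>{1..n}\<close>.\<close>

definition dsum :: "nat \<Rightarrow> (nat \<Rightarrow> 'v::zero set) \<Rightarrow> (nat \<Rightarrow> 'v) set" where
  "dsum n W = {v. (\<forall>j\<in>{1..n}. v j \<in> W j) \<and> (\<forall>j. j \<notin> {1..n} \<longrightarrow> v j = 0)}"

definition ordered_basis ::
    "('k::field \<Rightarrow> 'v::ab_group_add \<Rightarrow> 'v) \<Rightarrow> 'v set \<Rightarrow> 'v list \<Rightarrow> bool" where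
  "ordered_basis scale U bs \<longleftrightarrow>
    distinct bs \<and> \<not> Modules.module.dependent scale (set bs) \<and> Modules.module.span scale (set bs) = U"

definition matrix_wrt ::
    "('k::field \<Rightarrow> 'v::ab_group_add \<Rightarrow> 'v) \<Rightarrow> 'v list \<Rightarrow> ('v \<Rightarrow> 'v) \<Rightarrow> 'k mat" where
  "matrix_wrt scale bs f =
    mat (length bs) (length bs)
      (\<lambda>(a, b). Modules.module.representation scale (set bs) (f (bs ! b)) (bs ! a))"

text \<open>\<open>det (z\<^sup>2 I - A)\<close> as a polynomial in \<open>z\<close>.\<close>

definition det_sq_minus :: "'k::comm_ring_1 mat \<Rightarrow> 'k poly" where
  "det_sq_minus A =
    det (monom 1 2 \<cdot>\<^sub>m 1\<^sub>m (dim_row A) - map_mat (\<lambda>a. [:a:]) A)"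

section \<open>The twisted Long-Moody representation\<close>

text \<open>Operators on the \<open>n\<close>-fold direct sum in block form: block \<open>M a b\<close> (row \<open>a\<close>, column \<open>b\<close>) maps
  the \<open>b\<close>-th summand to the \<open>a\<close>-th, and tuples are column vectors.\<close>

definition block_op ::
    "nat \<Rightarrow> (nat \<Rightarrow> nat \<Rightarrow> 'v \<Rightarrow> 'v) \<Rightarrow> (nat \<Rightarrow> 'v::comm_monoid_add) \<Rightarrow> nat \<Rightarrow> 'v" where
  "block_op n M = (\<lambda>v \<in> dsum n (\<lambda>_. UNIV). \<lambda>a. if a \<in> {1..n} then \<Sum>b = 1..n. M a b (v b) else 0)"

context
  fixes scale :: "'k::field \<Rightarrow> 'v::ab_group_add \<Rightarrow> 'v"
    and n :: nat
    and l :: 'k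
    and \<rho> :: "free_braid_elt \<Rightarrow> 'v \<Rightarrow> 'v"
begin

definition LM_GL :: "((nat \<Rightarrow> 'v) \<Rightarrow> nat \<Rightarrow> 'v) monoid" where
  "LM_GL = GL_on (fun_scale scale) (dsum n (\<lambda>_. UNIV))"

definition LM_x :: "nat \<Rightarrow> (nat \<Rightarrow> 'v) \<Rightarrow> nat \<Rightarrow> 'v" where
  "LM_x i = block_op n (\<lambda>a b v.
     if a = i then
       (if b < i then scale l (\<rho> (fb_x n b) v - v)
        else if b = i then scale l (\<rho> (fb_x n i) v)
        else \<rho> (fb_x n b) v - v)
     else if a = b then v else 0)"

definition LM_sigma :: "nat \<Rightarrow> (nat \<Rightarrow> 'v) \<Rightarrow> nat \<Rightarrow> 'v" where
  "LM_sigma i =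
     block_op n (\<lambda>a b v. if a = b then \<rho> (fb_sigma n i) v else 0) \<otimes>\<^bsub>LM_GL\<^esub>
     block_op n (\<lambda>a b v.
       if a = i \<and> b = i then 0
       else if a = i \<and> b = i + 1 then \<rho> (fb_x n i) v
       else if a = i + 1 \<and> b = i then v
       else if a = i + 1 \<and> b = i + 1 then v - \<rho> (fb_x n (i + 1)) v
       else if a = b then v else 0)"

definition twisted_LM :: "free_braid_elt \<Rightarrow> (nat \<Rightarrow> 'v) \<Rightarrow> nat \<Rightarrow> 'v" where
  "twisted_LM = (\<lambda>(x, b).
     pres_lift {1..n} {} LM_GL LM_x x \<otimes>\<^bsub>LM_GL\<^esub> pres_lift {1..n - 1} (braid_rels n) LM_GL LM_sigma b)"

end

end

theory Submission
  imports Defs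
begin

text \<open>
  On \<open>K\<close> the entry \<open>I - g\<^bsub>i+1\<^esub>\<close> of the block \<open>R\<^sub>i\<close> acts as zero, so there \<open>S\<^sub>i\<close>
  merely exchanges the summands \<open>i\<close> and \<open>i + 1\<close>, up to \<open>s\<^sub>i\<close> and \<open>g\<^sub>i\<close>. Where \<open>s\<^sub>i\<close>
  and \<open>s\<^sub>i g\<^sub>i\<close> send the fixed spaces \<open>W\<^sub>j\<close> is read off from the images under \<open>\<rho>\<close> of
  the relations \<open>\<sigma>\<^sub>i x\<^sub>j = \<theta>(x\<^sub>j) \<sigma>\<^sub>i\<close>, that is from
  \<open>s\<^sub>i g\<^sub>i = g\<^bsub>i+1\<^esub> s\<^sub>i\<close>,
  \<open>g\<^bsub>i+1\<^esub> s\<^sub>i g\<^bsub>i+1\<^esub> = g\<^sub>i g\<^bsub>i+1\<^esub> s\<^sub>i\<close> and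
  \<open>s\<^sub>i g\<^sub>j = g\<^sub>j s\<^sub>i\<close> for the other \<open>j\<close>
  (lemmas \<open>s_g_self\<close>, \<open>s_g_Suc\<close>, \<open>s_g_other\<close>).

  For the characteristic polynomial, a basis \<open>c\<^sub>1, ..., c\<^sub>m\<close> of \<open>W\<^sub>i\<close> is completed to the
  basis \<open>(c\<^sub>1, 0), ..., (c\<^sub>m, 0), (0, s\<^sub>i c\<^sub>1), ..., (0, s\<^sub>i c\<^sub>m)\<close> of
  \<open>W\<^sub>i \<oplus> W\<^bsub>i+1\<^esub>\<close>. There \<open>P\<^sub>i\<close> has the block matrix with rows \<open>(0, M)\<close> and
  \<open>(I, 0)\<close>, where \<open>M\<close> is the matrix of \<open>s\<^sub>i g\<^sub>i s\<^sub>i\<close> on \<open>W\<^sub>i\<close>. The blocks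
  in the second row of \<open>z I - P\<^sub>i\<close> are scalar, hence commute, and the determinant is
  \<open>det (z\<^sup>2 I - M)\<close>
  (lemmas \<open>char_poly_anti_block_diagonal\<close> and \<open>char_poly_anti_diagonal_operator\<close>).

  Most of the work lies before this computation. The Artin action and the representation
  \<open>\<rho>\<^sup>L\<^sup>M\<close> are defined by evaluating words at prescribed values of the generators. Such an
  evaluation is constant on the classes of words only if the values are invertible and satisfy the
  defining relations. Hence the braid relations are verified twice: for the automorphisms
  \<open>\<theta>(\<sigma>\<^sub>i)\<close> of the free group, which gives access to the relations between \<open>s\<^sub>i\<close> and
  \<open>g\<^sub>j\<close> (\<open>artin_gen_satisfies_braid_rels\<close>), and for the Long-Moody operators themselves
  (\<open>LM_sigma_satisfies_braid_rels\<close>).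
\<close>

section \<open>Groups given by generators and relations\<close>

lemma words_simps [simp]:
  "[] \<in> words X"
  "u @ v \<in> words X \<longleftrightarrow> u \<in> words X \<and> v \<in> words X"
  "(x, e) # u \<in> words X \<longleftrightarrow> x \<in> X \<and> u \<in> words X"
  by (auto simp: words_def)

lemma pres_eq_words:
  assumes "pres_eq X R u v"
  shows "u \<in> words X" "v \<in> words X"
  using assms by (induction) auto

lemma pres_eq_append_right:
  assumes "pres_eq X R u u'" and w: "w \<in> words X"
  shows "pres_eq X R (u @ w) (u' @ w)"
  using assms(1)
proof induction
  case (cancel u v x e)
  then show ?case using pres_eq.cancel[of u X "v @ w" x R e] w by simp
next
  case (rel u v r s)
  then show ?case using pres_eq.rel[of u X "v @ w" r s R] w by simp
next
  case (refl u)
  then show ?case using w by (simp add: pres_eq.refl)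
qed (blast intro: pres_eq.sym pres_eq.trans)+

lemma pres_eq_append_left:
  assumes "pres_eq X R u u'" and w: "w \<in> words X"
  shows "pres_eq X R (w @ u) (w @ u')"
  using assms(1)
proof induction
  case (cancel u v x e)
  then show ?case using pres_eq.cancel[of "w @ u" X v x R e] w by simp
next
  case (rel u v r s)
  then show ?case using pres_eq.rel[of "w @ u" X v r s R] w by simp
next
  case (refl u)
  then show ?case using w by (simp add: pres_eq.refl)
qed (blast intro: pres_eq.sym pres_eq.trans)+

lemma pres_eq_append:
  assumes "pres_eq X R u u'" "pres_eq X R v v'"
  shows "pres_eq X R (u @ v) (u' @ v')"
  using assms by (meson pres_eq.trans pres_eq_append_left pres_eq_append_right pres_eq_words)

text \<open>The classes of words are the elements of the presented group; all computations in that group are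
  carried out on representatives.\<close>

definition word_class :: "'a set \<Rightarrow> ('a word \<times> 'a word) set \<Rightarrow> 'a word \<Rightarrow> 'a word set" where
  "word_class X R u = pres_rel X R `` {u}"

lemma mem_word_class: "v \<in> word_class X R u \<longleftrightarrow> pres_eq X R u v"
  by (simp add: word_class_def pres_rel_def)

lemma word_class_cong: "pres_eq X R u v \<Longrightarrow> word_class X R u = word_class X R v"
  by (rule Set.set_eqI) (metis mem_word_class pres_eq.sym pres_eq.trans)

lemma carrier_pres_group: "carrier (pres_group X R) = word_class X R ` words X"
  by (auto simp: pres_group_def quotient_def word_class_def)

lemma one_pres_group: "\<one>\<^bsub>pres_group X R\<^esub> = word_class X R []"
  by (simp add: pres_group_def word_class_def)

lemma pres_gen_eq: "pres_gen X R x = word_class X R [(x, True)]"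
  by (simp add: pres_gen_def word_class_def)

lemma mult_word_class:
  assumes "u \<in> words X" "v \<in> words X"
  shows "word_class X R u \<otimes>\<^bsub>pres_group X R\<^esub> word_class X R v = word_class X R (u @ v)"
proof -
  have "word_class X R (u' @ v') = word_class X R (u @ v)"
    if "u' \<in> word_class X R u" "v' \<in> word_class X R v" for u' v'
    using that
    by (auto simp: mem_word_class intro!: word_class_cong pres_eq_append intro: pres_eq.sym)
  moreover have "u \<in> word_class X R u" "v \<in> word_class X R v"
    using assms by (auto simp: mem_word_class intro: pres_eq.refl)
  ultimately have "(\<Union>u'\<in>word_class X R u. \<Union>v'\<in>word_class X R v. word_class X R (u' @ v'))
    = word_class X R (u @ v)"
    by blast
  then show ?thesis
    by (simp add: pres_group_def word_class_def)
qed

definition inv_word :: "'a word \<Rightarrow> 'a word" where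
  "inv_word u = rev (map (\<lambda>(x, e). (x, \<not> e)) u)"

lemma inv_word_simps [simp]:
  "inv_word [] = []" "inv_word ((x, e) # u) = inv_word u @ [(x, \<not> e)]"
  by (simp_all add: inv_word_def)

lemma inv_word_words [simp]: "u \<in> words X \<Longrightarrow> inv_word u \<in> words X"
  by (induction u) auto

lemma pres_eq_inv_word:
  "u \<in> words X \<Longrightarrow> pres_eq X R (inv_word u @ u) []"
proof (induction u)
  case (Cons a u)
  obtain x e where a: "a = (x, e)" by fastforce
  have "pres_eq X R (inv_word u @ [(x, \<not> e), (x, \<not> \<not> e)] @ u) (inv_word u @ u)"
    using Cons a by (intro pres_eq.cancel) auto
  then show ?case using Cons a by (auto intro: pres_eq.trans)
qed (simp add: pres_eq.refl)

lemma group_pres_group: "group (pres_group X R)"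
proof (rule groupI)
  fix x assume "x \<in> carrier (pres_group X R)"
  then obtain u where u: "u \<in> words X" "x = word_class X R u"
    by (auto simp: carrier_pres_group)
  have "word_class X R (inv_word u) \<otimes>\<^bsub>pres_group X R\<^esub> x = \<one>\<^bsub>pres_group X R\<^esub>"
    using u by (simp add: mult_word_class one_pres_group pres_eq_inv_word word_class_cong)
  then show "\<exists>y\<in>carrier (pres_group X R). y \<otimes>\<^bsub>pres_group X R\<^esub> x = \<one>\<^bsub>pres_group X R\<^esub>"
    using u by (auto simp: carrier_pres_group)
qed (auto simp: carrier_pres_group one_pres_group mult_word_class)

lemma pres_gen_carrier [simp, intro]: "x \<in> X \<Longrightarrow> pres_gen X R x \<in> carrier (pres_group X R)"
  by (simp add: pres_gen_eq carrier_pres_group)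

text \<open>A defining relation is only imposed between words in the generators, hence the guard.\<close>

definition satisfies_rels ::
    "'a set \<Rightarrow> ('a word \<times> 'a word) set \<Rightarrow> ('b, 'm) monoid_scheme \<Rightarrow> ('a \<Rightarrow> 'b) \<Rightarrow> bool" where
  "satisfies_rels X R H f \<longleftrightarrow>
    (\<forall>(r, s)\<in>R. r \<in> words X \<longrightarrow> s \<in> words X \<longrightarrow> word_eval H f r = word_eval H f s)"

lemma satisfies_rels_empty [simp]: "satisfies_rels X {} H f"
  by (simp add: satisfies_rels_def)

lemma word_eval_simps [simp]:
  "word_eval H f [] = \<one>\<^bsub>H\<^esub>"
  "word_eval H f ((x, e) # w) = (if e then f x else inv\<^bsub>H\<^esub> (f x)) \<otimes>\<^bsub>H\<^esub> word_eval H f w"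
  by (simp_all add: word_eval_def)

context group
begin

lemma word_eval_closed [simp]:
  "f \<in> X \<rightarrow> carrier G \<Longrightarrow> w \<in> words X \<Longrightarrow> word_eval G f w \<in> carrier G"
  by (induction w) (auto simp: Pi_iff)

lemma word_eval_append:
  "f \<in> X \<rightarrow> carrier G \<Longrightarrow> u \<in> words X \<Longrightarrow> v \<in> words X \<Longrightarrow>
    word_eval G f (u @ v) = word_eval G f u \<otimes> word_eval G f v"
  by (induction u) (auto simp: Pi_iff m_assoc)

text \<open>Each elementary move, cancellation or use of a relation, leaves the value of a word
  unchanged, so \<^const>\<open>word_eval\<close> descends to classes.\<close>

lemma word_eval_pres_eq:
  assumes "pres_eq X R u v" and f: "f \<in> X \<rightarrow> carrier G" and sat: "satisfies_rels X R G f"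
  shows "word_eval G f u = word_eval G f v"
  using assms(1)
proof induction
  case (cancel u v x e)
  then have "f x \<in> carrier G" using f by auto
  then have "word_eval G f [(x, e), (x, \<not> e)] = \<one>" by (cases e) auto
  then have "word_eval G f ([(x, e), (x, \<not> e)] @ v) = word_eval G f v"
    using cancel f by (subst word_eval_append[of f X]) auto
  then show ?case using cancel f by (simp add: word_eval_append[of f X] del: append_Cons append_Nil)
next
  case (rel u v r s)
  then have "word_eval G f r = word_eval G f s"
    using sat by (auto simp: satisfies_rels_def)
  then show ?case using rel f by (simp add: word_eval_append[of f X])
qed auto

lemma pres_lift_word_class:
  assumes f: "f \<in> X \<rightarrow> carrier G" "satisfies_rels X R G f" and u: "u \<in> words X"
  shows "pres_lift X R G f (word_class X R u) = word_eval G f u"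
proof -
  have "word_eval G f ` word_class X R u = {word_eval G f u}"
  proof
    show "word_eval G f ` word_class X R u \<subseteq> {word_eval G f u}"
      using word_eval_pres_eq[OF _ f] by (auto simp: mem_word_class)
    show "{word_eval G f u} \<subseteq> word_eval G f ` word_class X R u"
      using pres_eq.refl[OF u, of R] by (auto simp: mem_word_class)
  qed
  then show ?thesis
    using u by (simp add: pres_lift_def carrier_pres_group)
qed

text \<open>Existence in the universal property of a presented group; \<open>pres_group_hom_eqI\<close> below is
  uniqueness.\<close>

lemma pres_lift_hom:
  assumes f: "f \<in> X \<rightarrow> carrier G" "satisfies_rels X R G f"
  shows "pres_lift X R G f \<in> hom (pres_group X R) G"
  using f by (intro homI)
    (auto simp: carrier_pres_group mult_word_class pres_lift_word_class word_eval_append)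

lemma pres_lift_pres_gen:
  assumes f: "f \<in> X \<rightarrow> carrier G" "satisfies_rels X R G f" and x: "x \<in> X"
  shows "pres_lift X R G f (pres_gen X R x) = f x"
  using f x by (auto simp: pres_gen_eq pres_lift_word_class Pi_iff)

lemma pres_lift_one:
  assumes f: "f \<in> X \<rightarrow> carrier G" "satisfies_rels X R G f"
  shows "pres_lift X R G f \<one>\<^bsub>pres_group X R\<^esub> = \<one>"
  using f by (simp add: one_pres_group pres_lift_word_class)

lemma hom_word_class:
  assumes h: "h \<in> hom (pres_group X R) G" and u: "u \<in> words X"
  shows "h (word_class X R u) = word_eval G (\<lambda>x. h (pres_gen X R x)) u"
  using u
proof (induction u)
  case Nil
  interpret P: group "pres_group X R" by (rule group_pres_group)
  show ?case using h P.is_group is_group by (simp add: hom_one flip: one_pres_group)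
next
  case (Cons a u)
  interpret P: group "pres_group X R" by (rule group_pres_group)
  interpret h: group_hom "pres_group X R" G h by unfold_locales (rule h)
  obtain x e where a: "a = (x, e)" by fastforce
  have x: "x \<in> X" and u: "u \<in> words X" using Cons.prems a by auto
  have neg: "word_class X R [(x, False)] = inv\<^bsub>pres_group X R\<^esub> pres_gen X R x"
    using x pres_eq_inv_word[of "[(x, True)]" X R]
    by (intro P.inv_equality[symmetric])
      (auto simp: pres_gen_eq carrier_pres_group mult_word_class one_pres_group word_class_cong)
  have "h (word_class X R (a # u)) = h (word_class X R [a] \<otimes>\<^bsub>pres_group X R\<^esub> word_class X R u)"
    using x u a by (simp add: mult_word_class)
  also have "\<dots> = h (word_class X R [a]) \<otimes> h (word_class X R u)"
    using x u a by (intro h.hom_mult) (auto simp: carrier_pres_group)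
  also have "h (word_class X R [a]) = (if e then h (pres_gen X R x) else inv (h (pres_gen X R x)))"
    using x by (auto simp: a neg pres_gen_eq[symmetric])
  finally show ?case using Cons.IH u a by simp
qed

end

text \<open>Both homomorphisms evaluate a word from their values on its letters.\<close>

lemma pres_group_hom_eqI:
  assumes "group H" and h: "h \<in> hom (pres_group X R) H" and k: "k \<in> hom (pres_group X R) H"
    and gen: "\<And>x. x \<in> X \<Longrightarrow> h (pres_gen X R x) = k (pres_gen X R x)"
    and a: "a \<in> carrier (pres_group X R)"
  shows "h a = k a"
proof -
  interpret group H by fact
  obtain u where u: "u \<in> words X" "a = word_class X R u" using a by (auto simp: carrier_pres_group)
  have "word_eval H (\<lambda>x. h (pres_gen X R x)) u = word_eval H (\<lambda>x. k (pres_gen X R x)) u"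
    using u(1) by (induction u) (auto simp: gen)
  then show ?thesis using u h k by (simp add: hom_word_class)
qed

section \<open>The Artin action and the semidirect product\<close>

text \<open>The number \<open>1\<close> occurs in the generating sets \<open>{1..n}\<close>, hence inside the groups themselves;
  rewriting it to \<open>Suc 0\<close> would hide these groups from the facts about them.\<close>

declare One_nat_def [simp del]

text \<open>Together with associativity and the rule for the inverse of a product, these rules bring
  products of generators and their inverses into reduced form, which decides equality of words.\<close>

lemma (in group) cancel_inv_left [simp]:
  "a \<in> carrier G \<Longrightarrow> b \<in> carrier G \<Longrightarrow> inv a \<otimes> (a \<otimes> b) = b"
  "a \<in> carrier G \<Longrightarrow> b \<in> carrier G \<Longrightarrow> a \<otimes> (inv a \<otimes> b) = b"
  by (simp_all flip: m_assoc)

lemma AutoGroup_simps: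
  "carrier (AutoGroup G) = auto G"
  "\<one>\<^bsub>AutoGroup G\<^esub> = (\<lambda>x\<in>carrier G. x)"
  "f \<in> auto G \<Longrightarrow> h \<in> auto G \<Longrightarrow> x \<in> carrier G \<Longrightarrow> (f \<otimes>\<^bsub>AutoGroup G\<^esub> h) x = f (h x)"
  by (auto simp: AutoGroup_def BijGroup_def auto_def compose_def)

lemma autoD:
  assumes "f \<in> auto G"
  shows "f \<in> hom G G" "f \<in> extensional (carrier G)"
  using assms by (auto simp: auto_def Bij_def)

text \<open>Applied below both to the Artin automorphisms and to the Long-Moody operators.\<close>

lemma satisfies_braid_relsI:
  assumes "group H" and f: "f \<in> {1..n - 1} \<rightarrow> carrier H"
    and far: "\<And>i j. 1 \<le> i \<Longrightarrow> i + 2 \<le> j \<Longrightarrow> j + 1 \<le> n \<Longrightarrow> f i \<otimes>\<^bsub>H\<^esub> f j = f j \<otimes>\<^bsub>H\<^esub> f i"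
    and braid: "\<And>i. 1 \<le> i \<Longrightarrow> i + 2 \<le> n \<Longrightarrow>
      f i \<otimes>\<^bsub>H\<^esub> (f (i + 1) \<otimes>\<^bsub>H\<^esub> f i) = f (i + 1) \<otimes>\<^bsub>H\<^esub> (f i \<otimes>\<^bsub>H\<^esub> f (i + 1))"
  shows "satisfies_rels {1..n - 1} (braid_rels n) H f"
proof -
  interpret group H by fact
  have c: "f k \<in> carrier H" if "1 \<le> k" "k \<le> n - 1" for k
    using f that by auto
  show ?thesis
    unfolding satisfies_rels_def braid_rels_def
  proof safe
    fix i j assume "i \<in> {1..n - 1}" "j \<in> {1..n - 1}" "i + 2 \<le> j"
    then show "word_eval H f [(i, True), (j, True)] = word_eval H f [(j, True), (i, True)]"
      using far[of i j] c[of i] c[of j] by simp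
  next
    fix i assume "i \<in> {1..n - 1}" "i + 1 \<in> {1..n - 1}"
    then show "word_eval H f [(i, True), (i + 1, True), (i, True)] =
        word_eval H f [(i + 1, True), (i, True), (i + 1, True)]"
      using braid[of i] c[of i] c[of "i + 1"] by simp
  qed
qed

lemma free_hom_eqI:
  assumes "h \<in> hom (free_grp n) (free_grp n)" "k \<in> hom (free_grp n) (free_grp n)"
    and "\<And>j. 1 \<le> j \<Longrightarrow> j \<le> n \<Longrightarrow> h (free_gen n j) = k (free_gen n j)"
    and "a \<in> carrier (free_grp n)"
  shows "h a = k a"
  by (rule pres_group_hom_eqI[OF group_pres_group assms(1,2) _ assms(4)]) (simp add: assms(3))

lemma artin_gen_hom:
  assumes "1 \<le> i" "i + 1 \<le> n"
  shows "artin_gen n i \<in> hom (free_grp n) (free_grp n)"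
proof -
  interpret F: group "free_grp n" by (rule group_pres_group)
  show ?thesis
    unfolding artin_gen_def using assms
    by (intro F.pres_lift_hom) (auto intro!: F.m_closed F.inv_closed)
qed

lemma artin_gen_free_gen:
  assumes "1 \<le> i" "i + 1 \<le> n" "1 \<le> j" "j \<le> n"
  shows "artin_gen n i (free_gen n j) =
    (if j = i then free_gen n (i + 1)
     else if j = i + 1 then
       inv\<^bsub>free_grp n\<^esub> (free_gen n (i + 1)) \<otimes>\<^bsub>free_grp n\<^esub> free_gen n i \<otimes>\<^bsub>free_grp n\<^esub> free_gen n (i + 1)
     else free_gen n j)"
proof -
  interpret F: group "free_grp n" by (rule group_pres_group)
  show ?thesis
    unfolding artin_gen_def using assms
    by (subst F.pres_lift_pres_gen) (auto intro!: F.m_closed F.inv_closed)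
qed

text \<open>The inverse automorphism sends \<open>x\<^sub>i\<close> to \<open>x\<^sub>i x\<^bsub>i+1\<^esub> x\<^sub>i\<^sup>-\<^sup>1\<close> and \<open>x\<^bsub>i+1\<^esub>\<close> to \<open>x\<^sub>i\<close>;
  that the two compositions are the identity only needs to be checked on generators.\<close>

lemma artin_gen_auto:
  assumes i: "1 \<le> i" "i + 1 \<le> n"
  shows "artin_gen n i \<in> auto (free_grp n)"
proof -
  let ?F = "free_grp n" and ?x = "free_gen n"
  interpret F: group ?F by (rule group_pres_group)
  define f where "f = (\<lambda>j. if j = i then ?x i \<otimes>\<^bsub>?F\<^esub> ?x (i + 1) \<otimes>\<^bsub>?F\<^esub> inv\<^bsub>?F\<^esub> (?x i)
    else if j = i + 1 then ?x i else ?x j)"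
  define h where "h = pres_lift {1..n} {} ?F f"
  have f: "f \<in> {1..n} \<rightarrow> carrier ?F"
    using i by (auto simp: f_def intro!: F.m_closed F.inv_closed)
  have h: "h \<in> hom ?F ?F" "\<And>j. 1 \<le> j \<Longrightarrow> j \<le> n \<Longrightarrow> h (?x j) = f j"
    using f by (simp_all add: h_def F.pres_lift_hom F.pres_lift_pres_gen)
  interpret h: group_hom ?F ?F h by unfold_locales (rule h)
  interpret a: group_hom ?F ?F "artin_gen n i" by unfold_locales (rule artin_gen_hom[OF i])
  have x: "?x j \<in> carrier ?F" if "1 \<le> j" "j \<le> n" for j using that by simp
  have id: "(\<lambda>a. a) \<in> hom ?F ?F" by (rule homI) auto
  have ha: "h (artin_gen n i a) = a" if "a \<in> carrier ?F" for a
  proof (rule free_hom_eqI[OF _ id _ that])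
    show "(\<lambda>a. h (artin_gen n i a)) \<in> hom ?F ?F" by (rule homI) auto
    fix j assume "1 \<le> j" "j \<le> n"
    then show "h (artin_gen n i (?x j)) = ?x j"
      using i x[of i] x[of "i + 1"]
      by (auto simp: artin_gen_free_gen h(2) f_def F.m_assoc simp del: pres_gen_carrier)
  qed
  have ah: "artin_gen n i (h a) = a" if "a \<in> carrier ?F" for a
  proof (rule free_hom_eqI[OF _ id _ that])
    show "(\<lambda>a. artin_gen n i (h a)) \<in> hom ?F ?F" by (rule homI) auto
    fix j assume "1 \<le> j" "j \<le> n"
    then show "artin_gen n i (h (?x j)) = ?x j"
      using i x[of i] x[of "i + 1"]
      by (auto simp: artin_gen_free_gen h(2) f_def F.m_assoc simp del: pres_gen_carrier)
  qed
  have "bij_betw (artin_gen n i) (carrier ?F) (carrier ?F)"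
    by (rule bij_betwI[where g = h]) (auto simp: ha ah)
  moreover have "artin_gen n i \<in> extensional (carrier ?F)"
    by (simp add: artin_gen_def pres_lift_def)
  ultimately show ?thesis
    using artin_gen_hom[OF i] by (simp add: auto_def Bij_def)
qed

text \<open>Automorphisms of a free group that agree on the generators are equal, and on each generator both
  sides of a braid relation reduce to the same word. For instance, both sides of the relation between
  \<open>\<theta>\<^sub>i\<close> and \<open>\<theta>\<^bsub>i+1\<^esub>\<close> send \<open>x\<^bsub>i+2\<^esub>\<close> to
  \<open>x\<^bsub>i+2\<^esub>\<^sup>-\<^sup>1 x\<^bsub>i+1\<^esub>\<^sup>-\<^sup>1 x\<^sub>i x\<^bsub>i+1\<^esub> x\<^bsub>i+2\<^esub>\<close>.\<close>

lemma artin_gen_satisfies_braid_rels: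
  "satisfies_rels {1..n - 1} (braid_rels n) (AutoGroup (free_grp n)) (artin_gen n)"
proof -
  let ?F = "free_grp n" and ?x = "free_gen n"
  interpret F: group ?F by (rule group_pres_group)
  interpret A: group "AutoGroup ?F" by (rule F.AutoGroup)
  have eqI: "h = k"
    if h: "h \<in> auto ?F" and k: "k \<in> auto ?F"
      and gen: "\<And>j. 1 \<le> j \<Longrightarrow> j \<le> n \<Longrightarrow> h (?x j) = k (?x j)" for h k
    using free_hom_eqI[OF autoD(1)[OF h] autoD(1)[OF k] gen] autoD(2)[OF h] autoD(2)[OF k]
    by (auto intro: extensionalityI)
  have auto: "artin_gen n i \<in> auto ?F" if "1 \<le> i" "i + 1 \<le> n" for i
    using artin_gen_auto that by blast
  have mult: "f \<otimes>\<^bsub>AutoGroup ?F\<^esub> h \<in> auto ?F" if "f \<in> auto ?F" "h \<in> auto ?F" for f h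
    using A.m_closed that by (simp add: AutoGroup_simps)
  have ghom: "group_hom ?F ?F (artin_gen n i)" if "1 \<le> i" "i + 1 \<le> n" for i
    using artin_gen_hom[OF that] by unfold_locales
  have x: "?x j \<in> carrier ?F" if "1 \<le> j" "j \<le> n" for j using that by simp
  show ?thesis
  proof (rule satisfies_braid_relsI[OF F.AutoGroup])
    show "artin_gen n \<in> {1..n - 1} \<rightarrow> carrier (AutoGroup ?F)"
      by (auto simp: AutoGroup_simps intro!: auto)
  next
    fix i j :: nat assume ij: "1 \<le> i" "i + 2 \<le> j" "j + 1 \<le> n"
    interpret i: group_hom ?F ?F "artin_gen n i" using ij by (intro ghom) auto
    interpret j: group_hom ?F ?F "artin_gen n j" using ij by (intro ghom) auto
    show "artin_gen n i \<otimes>\<^bsub>AutoGroup ?F\<^esub> artin_gen n j = artin_gen n j \<otimes>\<^bsub>AutoGroup ?F\<^esub> artin_gen n i"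
    proof (rule eqI)
      fix k assume "1 \<le> k" "k \<le> n"
      then show "(artin_gen n i \<otimes>\<^bsub>AutoGroup ?F\<^esub> artin_gen n j) (?x k) =
          (artin_gen n j \<otimes>\<^bsub>AutoGroup ?F\<^esub> artin_gen n i) (?x k)"
        using ij by (simp add: AutoGroup_simps auto artin_gen_free_gen)
    qed (use ij in \<open>auto intro!: mult auto\<close>)
  next
    fix i :: nat assume i: "1 \<le> i" "i + 2 \<le> n"
    let ?a = "artin_gen n i" and ?b = "artin_gen n (i + 1)"
    interpret a: group_hom ?F ?F ?a using i by (intro ghom) auto
    interpret b: group_hom ?F ?F ?b using i by (intro ghom) auto
    have ab: "?a \<in> auto ?F" "?b \<in> auto ?F" using i by (auto intro!: auto)
    show "?a \<otimes>\<^bsub>AutoGroup ?F\<^esub> (?b \<otimes>\<^bsub>AutoGroup ?F\<^esub> ?a) = ?b \<otimes>\<^bsub>AutoGroup ?F\<^esub> (?a \<otimes>\<^bsub>AutoGroup ?F\<^esub> ?b)"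
    proof (rule eqI)
      fix k assume k: "1 \<le> k" "k \<le> n"
      have "?a (?b (?a (?x k))) = ?b (?a (?b (?x k)))"
        using i k x[of i] x[of "i + 1"] x[of "i + 2"]
        by (simp add: artin_gen_free_gen F.m_assoc F.inv_mult_group)
      then show "(?a \<otimes>\<^bsub>AutoGroup ?F\<^esub> (?b \<otimes>\<^bsub>AutoGroup ?F\<^esub> ?a)) (?x k) =
          (?b \<otimes>\<^bsub>AutoGroup ?F\<^esub> (?a \<otimes>\<^bsub>AutoGroup ?F\<^esub> ?b)) (?x k)"
        using k x[of k] by (simp add: AutoGroup_simps ab mult)
    qed (use ab in \<open>auto intro!: mult\<close>)
  qed
qed

lemma
  shows artin_hom: "artin n \<in> hom (braid_grp n) (AutoGroup (free_grp n))"
    and artin_braid_gen: "1 \<le> i \<Longrightarrow> i + 1 \<le> n \<Longrightarrow> artin n (braid_gen n i) = artin_gen n i"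
proof -
  interpret A: group "AutoGroup (free_grp n)" by (intro group.AutoGroup group_pres_group)
  have c: "artin_gen n \<in> {1..n - 1} \<rightarrow> carrier (AutoGroup (free_grp n))"
    by (auto simp: AutoGroup_simps intro!: artin_gen_auto)
  show "artin n \<in> hom (braid_grp n) (AutoGroup (free_grp n))"
    unfolding artin_def by (intro A.pres_lift_hom c artin_gen_satisfies_braid_rels)
  show "1 \<le> i \<Longrightarrow> i + 1 \<le> n \<Longrightarrow> artin n (braid_gen n i) = artin_gen n i"
    unfolding artin_def by (intro A.pres_lift_pres_gen c artin_gen_satisfies_braid_rels) auto
qed

text \<open>A homomorphism out of a semidirect product restricts to homomorphisms on the two factors, and
  these are linked by the action; the last equation is the image of \<open>b a = \<theta>(b)(a) b\<close>.\<close>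

lemma semidirect_hom:
  assumes "group G" "group H" and \<theta>: "\<theta> \<in> hom H (AutoGroup G)"
    and \<rho>: "\<rho> \<in> hom (semidirect G H \<theta>) K"
  shows "(\<lambda>a. \<rho> (a, \<one>\<^bsub>H\<^esub>)) \<in> hom G K" (is ?left)
    and "(\<lambda>b. \<rho> (\<one>\<^bsub>G\<^esub>, b)) \<in> hom H K" (is ?right)
    and "a \<in> carrier G \<Longrightarrow> b \<in> carrier H \<Longrightarrow>
      \<rho> (\<one>\<^bsub>G\<^esub>, b) \<otimes>\<^bsub>K\<^esub> \<rho> (a, \<one>\<^bsub>H\<^esub>) = \<rho> (\<theta> b a, \<one>\<^bsub>H\<^esub>) \<otimes>\<^bsub>K\<^esub> \<rho> (\<one>\<^bsub>G\<^esub>, b)"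
proof -
  interpret G: group G by fact
  interpret H: group H by fact
  interpret A: group "AutoGroup G" by (rule G.AutoGroup)
  interpret \<theta>: group_hom H "AutoGroup G" \<theta> by unfold_locales (rule \<theta>)
  have \<theta>_auto: "\<theta> b \<in> auto G" if "b \<in> carrier H" for b
    using \<theta>.hom_closed[OF that] by (simp add: AutoGroup_simps)
  have \<theta>_hom: "group_hom G G (\<theta> b)" if "b \<in> carrier H" for b
    using autoD(1)[OF \<theta>_auto[OF that]] by unfold_locales
  have \<theta>1: "\<theta> \<one>\<^bsub>H\<^esub> a = a" if "a \<in> carrier G" for a
    using that \<theta>.hom_one by (simp add: AutoGroup_simps)
  note [simp] = group_hom.hom_one[OF \<theta>_hom] group_hom.hom_closed[OF \<theta>_hom] \<theta>1
  have mult: "\<rho> (a, b) \<otimes>\<^bsub>K\<^esub> \<rho> (c, d) = \<rho> (a \<otimes>\<^bsub>G\<^esub> \<theta> b c, b \<otimes>\<^bsub>H\<^esub> d)"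
    if "a \<in> carrier G" "b \<in> carrier H" "c \<in> carrier G" "d \<in> carrier H" for a b c d
    using hom_mult[OF \<rho>, of "(a, b)" "(c, d)"] that by (simp add: semidirect_def)
  have closed: "\<rho> (a, b) \<in> carrier K" if "a \<in> carrier G" "b \<in> carrier H" for a b
    using \<rho> that by (auto simp: semidirect_def hom_def Pi_iff)
  show ?left ?right
    by (auto intro!: homI simp: mult closed AutoGroup_simps)
  show "\<rho> (\<one>\<^bsub>G\<^esub>, b) \<otimes>\<^bsub>K\<^esub> \<rho> (a, \<one>\<^bsub>H\<^esub>) = \<rho> (\<theta> b a, \<one>\<^bsub>H\<^esub>) \<otimes>\<^bsub>K\<^esub> \<rho> (\<one>\<^bsub>G\<^esub>, b)"
    if "a \<in> carrier G" "b \<in> carrier H"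
    using that by (simp add: mult AutoGroup_simps)
qed

lemma
  shows braid_gen_far: "1 \<le> i \<Longrightarrow> i + 2 \<le> j \<Longrightarrow> j + 1 \<le> n \<Longrightarrow>
      braid_gen n i \<otimes>\<^bsub>braid_grp n\<^esub> braid_gen n j = braid_gen n j \<otimes>\<^bsub>braid_grp n\<^esub> braid_gen n i"
    and braid_gen_braid: "1 \<le> i \<Longrightarrow> i + 2 \<le> n \<Longrightarrow>
      braid_gen n i \<otimes>\<^bsub>braid_grp n\<^esub> (braid_gen n (i + 1) \<otimes>\<^bsub>braid_grp n\<^esub> braid_gen n i) =
      braid_gen n (i + 1) \<otimes>\<^bsub>braid_grp n\<^esub> (braid_gen n i \<otimes>\<^bsub>braid_grp n\<^esub> braid_gen n (i + 1))"
proof -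
  have rel: "word_class {1..n - 1} (braid_rels n) r = word_class {1..n - 1} (braid_rels n) s"
    if "(r, s) \<in> braid_rels n" "r \<in> words {1..n - 1}" "s \<in> words {1..n - 1}" for r s
    using pres_eq.rel[of "[]" _ "[]" r s] that by (intro word_class_cong) simp
  show "braid_gen n i \<otimes>\<^bsub>braid_grp n\<^esub> braid_gen n j = braid_gen n j \<otimes>\<^bsub>braid_grp n\<^esub> braid_gen n i"
    if "1 \<le> i" "i + 2 \<le> j" "j + 1 \<le> n"
    using that by (simp add: pres_gen_eq mult_word_class) (rule rel; force simp: braid_rels_def)
  show "braid_gen n i \<otimes>\<^bsub>braid_grp n\<^esub> (braid_gen n (i + 1) \<otimes>\<^bsub>braid_grp n\<^esub> braid_gen n i) =
      braid_gen n (i + 1) \<otimes>\<^bsub>braid_grp n\<^esub> (braid_gen n i \<otimes>\<^bsub>braid_grp n\<^esub> braid_gen n (i + 1))"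
    if "1 \<le> i" "i + 2 \<le> n"
  proof -
    have idx: "i \<le> n - 1" "i + 1 \<le> n - 1" using that by auto
    show ?thesis
      using that idx by (simp add: pres_gen_eq mult_word_class) (rule rel; force simp: braid_rels_def)
  qed
qed

section \<open>General linear groups\<close>

lemma
  shows carrier_GL_on: "carrier (GL_on scale U) = {f \<in> Bij U. linear_on scale U f}"
    and mult_GL_on: "f \<in> carrier (GL_on scale U) \<Longrightarrow> h \<in> carrier (GL_on scale U) \<Longrightarrow>
      f \<otimes>\<^bsub>GL_on scale U\<^esub> h = compose U f h"
  by (auto simp: GL_on_def BijGroup_def)

text \<open>The linear bijections form a subgroup of all bijections of \<open>U\<close>: the inverse of a linear bijection
  is linear.\<close>

lemma group_GL_on:
  assumes add: "\<And>u v. u \<in> U \<Longrightarrow> v \<in> U \<Longrightarrow> u + v \<in> U" and sc: "\<And>c v. v \<in> U \<Longrightarrow> scale c v \<in> U"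
  shows "group (GL_on scale U)"
  unfolding GL_on_def
proof (rule subgroup.subgroup_is_group[OF _ group_BijGroup], rule subgroup.intro)
  let ?L = "{f \<in> Bij U. linear_on scale U f}"
  show "?L \<subseteq> carrier (BijGroup U)" by (auto simp: BijGroup_def)
  show "\<one>\<^bsub>BijGroup U\<^esub> \<in> ?L" by (auto simp: BijGroup_def id_Bij linear_on_def add sc)
  show "f \<otimes>\<^bsub>BijGroup U\<^esub> h \<in> ?L" if "f \<in> ?L" "h \<in> ?L" for f h
  proof -
    have "h u \<in> U" if "u \<in> U" for u using \<open>h \<in> ?L\<close> Bij_imp_funcset that by fastforce
    with that show ?thesis
      by (simp add: BijGroup_def compose_Bij linear_on_def compose_eq add sc)
  qed
  show "inv\<^bsub>BijGroup U\<^esub> f \<in> ?L" if f: "f \<in> ?L" for f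
  proof -
    let ?i = "inv_into U f"
    have inj: "inj_on f U" and im: "f ` U = U" and lin: "linear_on scale U f"
      using f by (auto simp: Bij_def bij_betw_def)
    have i: "?i u \<in> U" "f (?i u) = u" if "u \<in> U" for u
      using that im by (auto intro: inv_into_into f_inv_into_f)
    have "?i (u + v) = ?i u + ?i v" if "u \<in> U" "v \<in> U" for u v
      using that i lin by (intro inv_into_f_eq[OF inj]) (auto simp: add linear_on_def)
    moreover have "?i (scale c v) = scale c (?i v)" if "v \<in> U" for c v
      using that i lin by (intro inv_into_f_eq[OF inj]) (auto simp: sc linear_on_def)
    ultimately show ?thesis
      using f by (simp add: inv_BijGroup restrict_inv_into_Bij linear_on_def add sc)
  qed
qed

lemma GL_on_eqI:
  assumes "f \<in> carrier (GL_on scale U)" "h \<in> carrier (GL_on scale U)" "\<And>v. v \<in> U \<Longrightarrow> f v = h v"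
  shows "f = h"
  using assms by (intro extensionalityI[of f U h]) (auto simp: carrier_GL_on Bij_def)

lemma GL_on_closed: "f \<in> carrier (GL_on scale U) \<Longrightarrow> v \<in> U \<Longrightarrow> f v \<in> U"
  by (auto simp: carrier_GL_on dest: Bij_imp_funcset)

section \<open>Block operators\<close>

lemma linear_on_If:
  "linear_on scale U f \<Longrightarrow> linear_on scale U h \<Longrightarrow>
    linear_on scale U (\<lambda>v. if P then f v else h v)"
  by (cases P) simp_all

lemma (in vector_space) linear_on_basic:
  "linear_on scale U (\<lambda>v. 0)" "linear_on scale U (\<lambda>v. v)"
  "linear_on scale U f \<Longrightarrow> linear_on scale U h \<Longrightarrow> linear_on scale U (\<lambda>v. f v - h v)"
  "linear_on scale U f \<Longrightarrow> linear_on scale U (\<lambda>v. scale c (f v))"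
  by (simp_all add: linear_on_def scale_right_diff_distrib scale_right_distrib mult.commute)

abbreviation tuples :: "nat \<Rightarrow> (nat \<Rightarrow> 'v::zero) set" where
  "tuples n \<equiv> dsum n (\<lambda>_. UNIV)"

lemma tuples_iff: "v \<in> tuples n \<longleftrightarrow> (\<forall>a. a \<notin> {1..n} \<longrightarrow> v a = 0)"
  by (simp add: dsum_def)

lemma block_op_apply:
  "v \<in> tuples n \<Longrightarrow> block_op n M v = (\<lambda>a. if a \<in> {1..n} then \<Sum>b = 1..n. M a b (v b) else 0)"
  by (simp add: block_op_def)

context vector_space
begin

lemma linear_on_UNIV_simps:
  assumes "linear_on scale UNIV f"
  shows "f (u + v) = f u + f v" "f (scale c v) = scale c (f v)" "f 0 = 0" "f (- v) = - f v"
    "f (u - v) = f u - f v" "f (\<Sum>b\<in>B. h b) = (\<Sum>b\<in>B. f (h b))"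
proof -
  show add: "f (u + v) = f u + f v" and sc: "f (scale c v) = scale c (f v)" for u v c
    using assms by (auto simp: linear_on_def)
  show zero: "f 0 = 0" using sc[of 0 0] by simp
  show neg: "f (- v) = - f v" for v using sc[of "-1" v] by simp
  show "f (u - v) = f u - f v" using add[of u "- v"] neg by simp
  show "f (\<Sum>b\<in>B. h b) = (\<Sum>b\<in>B. f (h b))"
    by (induction B rule: infinite_finite_induct) (auto simp: add zero)
qed

lemma group_GL_tuples: "group (GL_on (fun_scale scale) (tuples n))"
  by (rule group_GL_on) (auto simp: tuples_iff fun_scale_def)

lemma linear_on_block_op:
  assumes "\<And>a b. a \<in> {1..n} \<Longrightarrow> b \<in> {1..n} \<Longrightarrow> linear_on scale UNIV (M a b)"
  shows "linear_on (fun_scale scale) (tuples n) (block_op n M)"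
  unfolding linear_on_def
proof safe
  note lin = linear_on_UNIV_simps[OF assms]
  fix u v :: "nat \<Rightarrow> 'b" assume uv: "u \<in> tuples n" "v \<in> tuples n"
  then have "u + v \<in> tuples n" by (simp add: tuples_iff)
  with uv show "block_op n M (u + v) = block_op n M u + block_op n M v"
    by (auto simp: block_op_apply fun_eq_iff lin sum.distrib)
next
  note lin = linear_on_UNIV_simps[OF assms]
  fix c and v :: "nat \<Rightarrow> 'b" assume v: "v \<in> tuples n"
  then have "fun_scale scale c v \<in> tuples n" by (simp add: tuples_iff fun_scale_def)
  with v show "block_op n M (fun_scale scale c v) = fun_scale scale c (block_op n M v)"
    by (auto simp: block_op_apply fun_eq_iff fun_scale_def lin scale_sum_right)
qed

lemma block_op_GL:
  assumes "\<And>a b. a \<in> {1..n} \<Longrightarrow> b \<in> {1..n} \<Longrightarrow> linear_on scale UNIV (M a b)"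
    and inj: "\<And>u v. u \<in> tuples n \<Longrightarrow> v \<in> tuples n \<Longrightarrow> block_op n M u = block_op n M v \<Longrightarrow> u = v"
    and surj: "\<And>p. p \<in> tuples n \<Longrightarrow> \<exists>v\<in>tuples n. block_op n M v = p"
  shows "block_op n M \<in> carrier (GL_on (fun_scale scale) (tuples n))"
proof -
  have "block_op n M v \<in> tuples n" if "v \<in> tuples n" for v
    using that by (simp add: block_op_apply tuples_iff)
  moreover have "inj_on (block_op n M) (tuples n)" using inj by (rule inj_onI)
  ultimately have "bij_betw (block_op n M) (tuples n) (tuples n)"
    using surj by (force simp: bij_betw_def)
  moreover have "block_op n M \<in> extensional (tuples n)" by (simp add: block_op_def)
  ultimately show ?thesis using linear_on_block_op[OF assms(1)] by (simp add: carrier_GL_on Bij_def)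
qed

end

section \<open>Representations of the semidirect product\<close>

locale free_braid_rep = vector_space scale
  for scale :: "'k::field \<Rightarrow> 'v::ab_group_add \<Rightarrow> 'v" +
  fixes n :: nat and \<rho> :: "free_braid_elt \<Rightarrow> 'v \<Rightarrow> 'v"
  assumes \<rho>_hom: "\<rho> \<in> hom (free_braid_grp n) (GL_on scale UNIV)"
begin

abbreviation GL :: "('v \<Rightarrow> 'v) monoid" where
  "GL \<equiv> GL_on scale UNIV"

definition g :: "nat \<Rightarrow> 'v \<Rightarrow> 'v" where
  "g j = \<rho> (fb_x n j)"

definition s :: "nat \<Rightarrow> 'v \<Rightarrow> 'v" where
  "s i = \<rho> (fb_sigma n i)"

sublocale GL: group GL
  by (rule group_GL_on) auto

lemma GL_mult_apply: "f \<in> carrier GL \<Longrightarrow> h \<in> carrier GL \<Longrightarrow> (f \<otimes>\<^bsub>GL\<^esub> h) v = f (h v)"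
  by (simp add: mult_GL_on compose_eq)

lemma
  shows free_hom: "(\<lambda>a. \<rho> (a, \<one>\<^bsub>braid_grp n\<^esub>)) \<in> hom (free_grp n) GL"
    and braid_hom: "(\<lambda>b. \<rho> (\<one>\<^bsub>free_grp n\<^esub>, b)) \<in> hom (braid_grp n) GL"
    and artin_equivariant: "a \<in> carrier (free_grp n) \<Longrightarrow> b \<in> carrier (braid_grp n) \<Longrightarrow>
      \<rho> (\<one>\<^bsub>free_grp n\<^esub>, b) \<otimes>\<^bsub>GL\<^esub> \<rho> (a, \<one>\<^bsub>braid_grp n\<^esub>) =
      \<rho> (artin n b a, \<one>\<^bsub>braid_grp n\<^esub>) \<otimes>\<^bsub>GL\<^esub> \<rho> (\<one>\<^bsub>free_grp n\<^esub>, b)"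
  using semidirect_hom[OF group_pres_group group_pres_group artin_hom \<rho>_hom[unfolded free_braid_grp_def]]
  by blast+

lemma g_GL: "1 \<le> j \<Longrightarrow> j \<le> n \<Longrightarrow> g j \<in> carrier GL"
  using hom_in_carrier[OF free_hom, of "free_gen n j"] by (simp add: g_def fb_x_def)

lemma s_GL: "1 \<le> i \<Longrightarrow> i + 1 \<le> n \<Longrightarrow> s i \<in> carrier GL"
  using hom_in_carrier[OF braid_hom, of "braid_gen n i"] by (simp add: s_def fb_sigma_def)

lemma GL_linear: "f \<in> carrier GL \<Longrightarrow> linear_on scale UNIV f"
  and GL_bij: "f \<in> carrier GL \<Longrightarrow> bij f"
  by (auto simp: carrier_GL_on Bij_def)

text \<open>Equivariance under \<open>\<sigma>\<^sub>i\<close>, evaluated at the generator \<open>x\<^sub>j\<close>.\<close>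

lemma s_g:
  assumes i: "1 \<le> i" "i + 1 \<le> n" and j: "1 \<le> j" "j \<le> n"
  shows "s i \<otimes>\<^bsub>GL\<^esub> g j =
    (if j = i then g (i + 1)
     else if j = i + 1 then inv\<^bsub>GL\<^esub> g (i + 1) \<otimes>\<^bsub>GL\<^esub> g i \<otimes>\<^bsub>GL\<^esub> g (i + 1)
     else g j) \<otimes>\<^bsub>GL\<^esub> s i"
proof -
  interpret F: group "free_grp n" by (rule group_pres_group)
  interpret r: group_hom "free_grp n" GL "\<lambda>a. \<rho> (a, \<one>\<^bsub>braid_grp n\<^esub>)"
    by unfold_locales (rule free_hom)
  have x: "free_gen n k \<in> carrier (free_grp n)" if "1 \<le> k" "k \<le> n" for k using that by simp
  have g: "\<rho> (free_gen n k, \<one>\<^bsub>braid_grp n\<^esub>) = g k" for k by (simp add: g_def fb_x_def)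
  have "s i \<otimes>\<^bsub>GL\<^esub> g j = \<rho> (artin_gen n i (free_gen n j), \<one>\<^bsub>braid_grp n\<^esub>) \<otimes>\<^bsub>GL\<^esub> s i"
    using artin_equivariant[of "free_gen n j" "braid_gen n i"] i j
    by (simp add: s_def g_def fb_sigma_def fb_x_def artin_braid_gen)
  also have "\<rho> (artin_gen n i (free_gen n j), \<one>\<^bsub>braid_grp n\<^esub>) =
    (if j = i then g (i + 1)
     else if j = i + 1 then inv\<^bsub>GL\<^esub> g (i + 1) \<otimes>\<^bsub>GL\<^esub> g i \<otimes>\<^bsub>GL\<^esub> g (i + 1)
     else g j)"
    using i j x[of i] x[of "i + 1"] by (simp add: artin_gen_free_gen g)
  finally show ?thesis .
qed

text \<open>The three cases applied to a vector. In the second one, \<open>s\<^sub>i g\<^bsub>i+1\<^esub> = g\<^bsub>i+1\<^esub>\<^sup>-\<^sup>1 g\<^sub>i g\<^bsub>i+1\<^esub> s\<^sub>i\<close>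
  is multiplied by \<open>g\<^bsub>i+1\<^esub>\<close>, so that no inverse operator appears.\<close>

lemma
  assumes i: "1 \<le> i" "i + 1 \<le> n"
  shows s_g_self: "s i (g i v) = g (i + 1) (s i v)"
    and s_g_Suc: "g (i + 1) (s i (g (i + 1) v)) = g i (g (i + 1) (s i v))"
    and s_g_other: "1 \<le> j \<Longrightarrow> j \<le> n \<Longrightarrow> j \<noteq> i \<Longrightarrow> j \<noteq> i + 1 \<Longrightarrow> s i (g j v) = g j (s i v)"
proof -
  have c: "s i \<in> carrier GL" "g i \<in> carrier GL" "g (i + 1) \<in> carrier GL"
    using i by (auto intro: s_GL g_GL)
  show "s i (g i v) = g (i + 1) (s i v)"
    using fun_cong[OF s_g[OF i, of i], of v] i c by (simp add: GL_mult_apply)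
  show "s i (g j v) = g j (s i v)" if "1 \<le> j" "j \<le> n" "j \<noteq> i" "j \<noteq> i + 1"
    using fun_cong[OF s_g[OF i, of j], of v] that c g_GL[of j] by (simp add: GL_mult_apply)
  have "g (i + 1) \<otimes>\<^bsub>GL\<^esub> (s i \<otimes>\<^bsub>GL\<^esub> g (i + 1)) = g i \<otimes>\<^bsub>GL\<^esub> (g (i + 1) \<otimes>\<^bsub>GL\<^esub> s i)"
    using s_g[OF i, of "i + 1"] i c by (simp add: GL.m_assoc)
  from fun_cong[OF this, of v] show "g (i + 1) (s i (g (i + 1) v)) = g i (g (i + 1) (s i v))"
    using c by (simp add: GL_mult_apply)
qed

lemma s_far:
  assumes "1 \<le> i" "i + 2 \<le> j" "j + 1 \<le> n"
  shows "s i (s j v) = s j (s i v)"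
proof -
  have m: "braid_gen n i \<in> carrier (braid_grp n)" "braid_gen n j \<in> carrier (braid_grp n)"
    using assms by auto
  have "s i \<otimes>\<^bsub>GL\<^esub> s j = s j \<otimes>\<^bsub>GL\<^esub> s i"
    using m braid_gen_far[OF assms] by (simp add: s_def fb_sigma_def flip: hom_mult[OF braid_hom])
  from fun_cong[OF this, of v] show ?thesis
    using assms by (simp add: GL_mult_apply s_GL)
qed

lemma s_braid:
  assumes "1 \<le> i" "i + 2 \<le> n"
  shows "s i (s (i + 1) (s i v)) = s (i + 1) (s i (s (i + 1) v))"
proof -
  interpret B: group "braid_grp n" by (rule group_pres_group)
  have m: "braid_gen n i \<in> carrier (braid_grp n)" "braid_gen n (i + 1) \<in> carrier (braid_grp n)"
    using assms by auto
  have "s i \<otimes>\<^bsub>GL\<^esub> (s (i + 1) \<otimes>\<^bsub>GL\<^esub> s i) = s (i + 1) \<otimes>\<^bsub>GL\<^esub> (s i \<otimes>\<^bsub>GL\<^esub> s (i + 1))"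
    using m braid_gen_braid[OF assms]
    by (simp add: s_def fb_sigma_def flip: hom_mult[OF braid_hom])
  from fun_cong[OF this, of v] show ?thesis
    using assms by (simp add: GL_mult_apply s_GL)
qed

end

section \<open>The braid relations for the Long-Moody operators\<close>

context free_braid_rep
begin

lemma linear_g: "1 \<le> j \<Longrightarrow> j \<le> n \<Longrightarrow> linear_on scale UNIV (g j)"
  and linear_s: "1 \<le> i \<Longrightarrow> i + 1 \<le> n \<Longrightarrow> linear_on scale UNIV (s i)"
  by (auto intro: GL_linear g_GL s_GL)

lemma g_simps:
  assumes "1 \<le> j" "j \<le> n"
  shows "g j (u + v) = g j u + g j v" "g j (scale c v) = scale c (g j v)" "g j 0 = 0"
    "g j (u - v) = g j u - g j v" "g j u = g j v \<longleftrightarrow> u = v" "\<exists>u. g j u = v"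
proof -
  note bij = GL_bij[OF g_GL[OF assms]]
  obtain u where "v = g j u" using surjD[OF bij_is_surj[OF bij]] by blast
  then show "\<exists>u. g j u = v" by blast
qed (use linear_on_UNIV_simps[OF GL_linear[OF g_GL[OF assms]]] GL_bij[OF g_GL[OF assms]] in
    \<open>auto simp: bij_def inj_eq\<close>)

lemma s_simps:
  assumes "1 \<le> i" "i + 1 \<le> n"
  shows "s i (u + v) = s i u + s i v" "s i (scale c v) = scale c (s i v)" "s i 0 = 0"
    "s i (u - v) = s i u - s i v" "s i u = s i v \<longleftrightarrow> u = v" "\<exists>u. s i u = v"
proof -
  note bij = GL_bij[OF s_GL[OF assms]]
  obtain u where "v = s i u" using surjD[OF bij_is_surj[OF bij]] by blast
  then show "\<exists>u. s i u = v" by blast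
qed (use linear_on_UNIV_simps[OF GL_linear[OF s_GL[OF assms]]] GL_bij[OF s_GL[OF assms]] in
    \<open>auto simp: bij_def inj_eq\<close>)

lemma group_LM_GL: "group (LM_GL scale n)"
  unfolding LM_GL_def by (rule group_GL_tuples)

text \<open>Only row \<open>i\<close> of this operator differs from the identity, and its diagonal entry \<open>l g\<^sub>i\<close> is
  invertible, so coordinate \<open>i\<close> of a preimage can be solved for once the other coordinates are known.
  Through this lemma the \<open>F\<^sub>n\<close>-part of the Long-Moody representation is trivial at the neutral element.\<close>

lemma LM_x_GL:
  assumes l: "l \<noteq> 0" and i: "1 \<le> i" "i \<le> n"
  shows "LM_x scale n l \<rho> i \<in> carrier (LM_GL scale n)"
proof -
  define M where "M = (\<lambda>a b v.
     if a = i then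
       (if b < i then scale l (g b v - v) else if b = i then scale l (g i v) else g b v - v)
     else if a = b then v else 0)"
  have LM_x: "LM_x scale n l \<rho> i = block_op n M"
    unfolding LM_x_def M_def g_def ..
  define c where "c = (\<lambda>v. \<Sum>b\<in>{1..n} - {i}. M i b (v b))"
  have apply_M: "block_op n M v = (\<lambda>a. if a = i then scale l (g i (v i)) + c v else v a)"
    if "v \<in> tuples n" for v
  proof
    fix a
    have "(\<Sum>b = 1..n. M i b (v b)) = scale l (g i (v i)) + c v"
      using i by (subst sum.remove[of _ i]) (auto simp: c_def M_def)
    moreover have "(\<Sum>b = 1..n. M a b (v b)) = v a" if "a \<noteq> i" "a \<in> {1..n}"
      using that by (simp add: M_def)
    ultimately show "block_op n M v a = (if a = i then scale l (g i (v i)) + c v else v a)"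
      using that i by (auto simp: block_op_apply tuples_iff)
  qed
  have c_cong: "c u = c v" if "\<And>b. b \<noteq> i \<Longrightarrow> u b = v b" for u v
    unfolding c_def using that by (intro sum.cong) auto
  show ?thesis
    unfolding LM_x LM_GL_def
  proof (rule block_op_GL)
    fix a b assume "a \<in> {1..n}" "b \<in> {1..n}"
    then show "linear_on scale UNIV (M a b)"
      unfolding M_def using i by (intro linear_on_If linear_on_basic linear_g) auto
  next
    fix u v :: "nat \<Rightarrow> 'v"
    assume uv: "u \<in> tuples n" "v \<in> tuples n" "block_op n M u = block_op n M v"
    then have *: "(if a = i then scale l (g i (u i)) + c u else u a) =
        (if a = i then scale l (g i (v i)) + c v else v a)" for a
      by (simp add: apply_M fun_eq_iff)
    have off: "u a = v a" if "a \<noteq> i" for a using *[of a] that by simp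
    have "u i = v i" using *[of i] c_cong[OF off] l i by (simp add: g_simps)
    with off show "u = v" by (metis ext)
  next
    fix p :: "nat \<Rightarrow> 'v" assume p: "p \<in> tuples n"
    obtain u where u: "g i u = scale (1 / l) (p i - c p)" using g_simps(6)[OF i] by blast
    have mem: "p(i := u) \<in> tuples n" using p i by (auto simp: tuples_iff)
    moreover have "block_op n M (p(i := u)) = p"
      using u l c_cong[of "p(i := u)" p] by (auto simp: apply_M[OF mem])
    ultimately show "\<exists>v\<in>tuples n. block_op n M v = p" by blast
  qed
qed

text \<open>The two factors of the Long-Moody operator of \<open>\<sigma>\<^sub>i\<close>: the diagonal \<open>s\<^sub>i\<^sup>\<oplus>\<^sup>n\<close> and the matrix that
  carries the block \<open>R\<^sub>i\<close>.\<close>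

definition diag_s :: "nat \<Rightarrow> (nat \<Rightarrow> 'v) \<Rightarrow> nat \<Rightarrow> 'v" where
  "diag_s i = block_op n (\<lambda>a b v. if a = b then s i v else 0)"

definition block_R :: "nat \<Rightarrow> (nat \<Rightarrow> 'v) \<Rightarrow> nat \<Rightarrow> 'v" where
  "block_R i = block_op n (\<lambda>a b v.
     if a = i \<and> b = i then 0
     else if a = i \<and> b = i + 1 then g i v
     else if a = i + 1 \<and> b = i then v
     else if a = i + 1 \<and> b = i + 1 then v - g (i + 1) v
     else if a = b then v else 0)"

lemma LM_sigma_eq: "LM_sigma scale n \<rho> i = diag_s i \<otimes>\<^bsub>LM_GL scale n\<^esub> block_R i"
  unfolding LM_sigma_def diag_s_def block_R_def s_def g_def ..

lemma diag_s_apply: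
  assumes i: "1 \<le> i" "i + 1 \<le> n" and v: "v \<in> tuples n"
  shows "diag_s i v = (\<lambda>a. s i (v a))"
proof
  fix a show "diag_s i v a = s i (v a)"
    using v by (auto simp: diag_s_def block_op_apply tuples_iff s_simps[OF i])
qed

lemma block_R_apply:
  assumes i: "1 \<le> i" "i + 1 \<le> n" and v: "v \<in> tuples n"
  shows "block_R i v = (\<lambda>a. if a = i then g i (v (i + 1))
    else if a = i + 1 then v i + v (i + 1) - g (i + 1) (v (i + 1)) else v a)"
proof
  fix a
  let ?M = "\<lambda>a b v. if a = i \<and> b = i then 0
     else if a = i \<and> b = i + 1 then g i v
     else if a = i + 1 \<and> b = i then v
     else if a = i + 1 \<and> b = i + 1 then v - g (i + 1) v
     else if a = b then v else 0"
  have "(\<Sum>b = 1..n. ?M i b (v b)) = (\<Sum>b = 1..n. if b = i + 1 then g i (v b) else 0)"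
    by (intro sum.cong) auto
  moreover have "(\<Sum>b = 1..n. ?M (i + 1) b (v b)) =
      (\<Sum>b = 1..n. (if b = i then v b else 0) + (if b = i + 1 then v b - g (i + 1) (v b) else 0))"
    by (intro sum.cong) auto
  moreover have "(\<Sum>b = 1..n. ?M a b (v b)) = (\<Sum>b = 1..n. if b = a then v b else 0)"
    if "a \<noteq> i" "a \<noteq> i + 1"
    using that by (intro sum.cong) auto
  ultimately show "block_R i v a = (if a = i then g i (v (i + 1))
      else if a = i + 1 then v i + v (i + 1) - g (i + 1) (v (i + 1)) else v a)"
    using i v unfolding block_R_def block_op_apply[OF v]
    by (auto simp: sum.distrib tuples_iff)
qed

lemma diag_s_GL:
  assumes i: "1 \<le> i" "i + 1 \<le> n"
  shows "diag_s i \<in> carrier (LM_GL scale n)"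
  unfolding diag_s_def LM_GL_def
proof (rule block_op_GL, goal_cases)
  case (1 a b)
  show ?case using i by (intro linear_on_If linear_on_basic linear_s) auto
next
  case (2 u v)
  then have "(\<lambda>a. s i (u a)) = (\<lambda>a. s i (v a))"
    using diag_s_apply[OF i] by (simp add: diag_s_def)
  then have "s i (u a) = s i (v a)" for a by (rule fun_cong)
  then show ?case using i by (simp add: fun_eq_iff s_simps(5))
next
  case (3 p)
  obtain t where t: "\<And>v. s i (t v) = v" using s_simps(6)[OF i] by metis
  have t0: "t 0 = 0" using t[of 0] s_simps(3,5)[OF i] by metis
  have mem: "(\<lambda>a. t (p a)) \<in> tuples n" using 3 t0 by (simp add: tuples_iff)
  then show ?case using diag_s_apply[OF i mem] t by (auto simp: diag_s_def)
qed

text \<open>From the image, coordinate \<open>i + 1\<close> is recovered first, by inverting \<open>g\<^sub>i\<close>, and then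
  coordinate \<open>i\<close>.\<close>

lemma block_R_GL:
  assumes i: "1 \<le> i" "i + 1 \<le> n"
  shows "block_R i \<in> carrier (LM_GL scale n)"
  unfolding block_R_def LM_GL_def
proof (rule block_op_GL, goal_cases)
  case (1 a b)
  show ?case using i by (intro linear_on_If linear_on_basic linear_g) auto
next
  case (2 u v)
  then have eq: "block_R i u a = block_R i v a" for a by (simp add: block_R_def)
  have "u (i + 1) = v (i + 1)" using eq[of i] 2 i by (simp add: block_R_apply g_simps)
  moreover have "u i = v i" using eq[of "i + 1"] 2 i calculation by (simp add: block_R_apply)
  moreover have "u a = v a" if "a \<noteq> i" "a \<noteq> i + 1" for a
    using eq[of a] 2 i that by (simp add: block_R_apply)
  ultimately show ?case by (intro ext) metis
next
  case (3 p)
  obtain w where w: "g i w = p i" using g_simps(6)[of i] i by auto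
  let ?v = "p(i + 1 := w, i := p (i + 1) - w + g (i + 1) w)"
  have mem: "?v \<in> tuples n" using 3 i by (auto simp: tuples_iff)
  have "block_R i ?v = p" unfolding block_R_apply[OF i mem] using w by (auto simp: fun_eq_iff)
  with mem show ?case by (metis block_R_def)
qed

lemma LM_sigma_GL:
  assumes "1 \<le> i" "i + 1 \<le> n"
  shows "LM_sigma scale n \<rho> i \<in> carrier (LM_GL scale n)"
  unfolding LM_sigma_eq
  using assms by (intro monoid.m_closed group.is_monoid group_LM_GL diag_s_GL block_R_GL)

lemma LM_mult_apply:
  assumes "f \<in> carrier (LM_GL scale n)" "h \<in> carrier (LM_GL scale n)" "v \<in> tuples n"
  shows "(f \<otimes>\<^bsub>LM_GL scale n\<^esub> h) v = f (h v)"
  using assms by (simp add: LM_GL_def mult_GL_on compose_eq)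

lemma LM_closed: "f \<in> carrier (LM_GL scale n) \<Longrightarrow> v \<in> tuples n \<Longrightarrow> f v \<in> tuples n"
  unfolding LM_GL_def by (rule GL_on_closed)

lemma LM_sigma_apply:
  assumes i: "1 \<le> i" "i + 1 \<le> n" and v: "v \<in> tuples n"
  shows "LM_sigma scale n \<rho> i v = (\<lambda>a. s i (if a = i then g i (v (i + 1))
    else if a = i + 1 then v i + v (i + 1) - g (i + 1) (v (i + 1)) else v a))"
proof -
  have "LM_sigma scale n \<rho> i v = (\<lambda>a. s i (block_R i v a))"
    unfolding LM_sigma_eq using assms
    by (simp add: LM_mult_apply diag_s_GL block_R_GL LM_closed diag_s_apply)
  then show ?thesis by (simp add: block_R_apply[OF assms])
qed

text \<open>Every entry of a product of Long-Moody operators is a sum of compositions of operators \<open>g\<^sub>a\<close> and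
  \<open>s\<^sub>b\<close>. For distant indices \<open>i, j\<close> it suffices that \<open>s\<^sub>i\<close> commutes with
  \<open>s\<^sub>j\<close>, \<open>g\<^sub>j\<close> and \<open>g\<^bsub>j+1\<^esub>\<close>, and \<open>s\<^sub>j\<close> with \<open>g\<^sub>i\<close> and \<open>g\<^bsub>i+1\<^esub>\<close>. For neighbouring indices
  \<open>i, j = i + 1\<close>, all factors \<open>g\<^sub>a\<^sup>\<plusminus>\<^sup>1\<close> are moved to the left of all factors \<open>s\<^sub>b\<close>; what remains on the
  right is \<open>s\<^sub>i s\<^sub>j s\<^sub>i = s\<^sub>j s\<^sub>i s\<^sub>j\<close>, and the words in the \<open>g\<^sub>a\<close> on the left
  are compared in reduced form.\<close>

lemma LM_sigma_satisfies_braid_rels: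
  "satisfies_rels {1..n - 1} (braid_rels n) (LM_GL scale n) (LM_sigma scale n \<rho>)"
proof (rule satisfies_braid_relsI[OF group_LM_GL])
  show "LM_sigma scale n \<rho> \<in> {1..n - 1} \<rightarrow> carrier (LM_GL scale n)"
    by (auto intro!: LM_sigma_GL)
next
  let ?L = "LM_sigma scale n \<rho>"
  interpret L: group "LM_GL scale n" by (rule group_LM_GL)
  fix i j assume ij: "1 \<le> i" "i + 2 \<le> j" "j + 1 \<le> n"
  have ne: "i \<noteq> j" "i + 1 \<noteq> j" "i \<noteq> j + 1" "j \<noteq> i" "j \<noteq> i + 1" "j + 1 \<noteq> i" using ij by auto
  have C: "?L i \<in> carrier (LM_GL scale n)" "?L j \<in> carrier (LM_GL scale n)"
    using ij by (auto intro!: LM_sigma_GL)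
  have sg: "s i (g j v) = g j (s i v)" "s i (g (j + 1) v) = g (j + 1) (s i v)"
    "s j (g i v) = g i (s j v)" "s j (g (i + 1) v) = g (i + 1) (s j v)" for v
    using ij by (auto intro!: s_g_other)
  show "?L i \<otimes>\<^bsub>LM_GL scale n\<^esub> ?L j = ?L j \<otimes>\<^bsub>LM_GL scale n\<^esub> ?L i"
  proof (rule GL_on_eqI[of _ "fun_scale scale" "tuples n"])
    fix v :: "nat \<Rightarrow> 'v" assume v: "v \<in> tuples n"
    have i: "1 \<le> i" "i + 1 \<le> n" and j: "1 \<le> j" "j + 1 \<le> n" using ij by auto
    have V: "?L i v \<in> tuples n" "?L j v \<in> tuples n" using C v by (auto intro: LM_closed)
    have "?L i (?L j v) = ?L j (?L i v)"
      unfolding LM_sigma_apply[OF i V(2)] LM_sigma_apply[OF j V(1)]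
      unfolding LM_sigma_apply[OF i v] LM_sigma_apply[OF j v]
      using ne
      by (intro ext)
        (simp add: sg[symmetric] s_far[OF ij, symmetric] s_simps[OF i] s_simps[OF j])
    then show "(?L i \<otimes>\<^bsub>LM_GL scale n\<^esub> ?L j) v = (?L j \<otimes>\<^bsub>LM_GL scale n\<^esub> ?L i) v"
      using C v by (simp add: LM_mult_apply)
  qed (use C in \<open>auto simp flip: LM_GL_def\<close>)
next
  let ?L = "LM_sigma scale n \<rho>"
  interpret L: group "LM_GL scale n" by (rule group_LM_GL)
  fix i assume i2: "1 \<le> i" "i + 2 \<le> n"
  define j k where "j = i + 1" and "k = j + 1"
  have i: "1 \<le> i" "i + 1 \<le> n" and j: "1 \<le> j" "j + 1 \<le> n" using i2 by (auto simp: j_def)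
  have ne: "i \<noteq> j" "j \<noteq> i" "i \<noteq> k" "k \<noteq> i" "j \<noteq> k" "k \<noteq> j" by (auto simp: j_def k_def)
  have C: "?L i \<in> carrier (LM_GL scale n)" "?L j \<in> carrier (LM_GL scale n)"
    using i j by (auto intro!: LM_sigma_GL)
  \<comment> \<open>The inverse of \<open>g m\<close>.\<close>
  define g' where "g' = (\<lambda>m v. SOME u. g m u = v)"
  have idx: "1 \<le> i" "i \<le> n" "1 \<le> j" "j \<le> n" "1 \<le> k" "k \<le> n"
    using i2 by (auto simp: j_def k_def)
  have gg': "g m (g' m v) = v" if "1 \<le> m" "m \<le> n" for m v
    unfolding g'_def using someI_ex[OF g_simps(6)[OF that]] .
  have g'g: "g' m (g m v) = v" if "1 \<le> m" "m \<le> n" for m v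
    using gg'[OF that] g_simps(5)[OF that] by blast
  have g'_lin: "g' m (u + v) = g' m u + g' m v" "g' m (u - v) = g' m u - g' m v"
    if "1 \<le> m" "m \<le> n" for m u v
    using gg'[OF that] g_simps[OF that] by metis+
  note inv = gg'[OF idx(1,2)] gg'[OF idx(3,4)] gg'[OF idx(5,6)]
    g'g[OF idx(1,2)] g'g[OF idx(3,4)] g'g[OF idx(5,6)]
  note lin = g_simps(1,4)[OF idx(1,2)] g_simps(1,4)[OF idx(3,4)] g_simps(1,4)[OF idx(5,6)]
    g'_lin[OF idx(1,2)] g'_lin[OF idx(3,4)] g'_lin[OF idx(5,6)] s_simps(1,4)[OF i] s_simps(1,4)[OF j]
  have push: "s i (g i v) = g j (s i v)" "s j (g j v) = g k (s j v)"
    "s i (g k v) = g k (s i v)" "s j (g i v) = g i (s j v)" for v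
    using s_g_self[OF i] s_g_self[OF j] s_g_other[OF i, of k] s_g_other[OF j, of i] ne idx
    by (auto simp: j_def k_def)
  have push_Suc: "s i (g j v) = g' j (g i (g j (s i v)))" "s j (g k v) = g' k (g j (g k (s j v)))" for v
    using s_g_Suc[OF i, of v] s_g_Suc[OF j, of v] inv by (metis j_def, metis k_def)
  have push': "s i (g' i v) = g' j (s i v)" "s j (g' j v) = g' k (s j v)"
    "s i (g' k v) = g' k (s i v)" "s j (g' i v) = g' i (s j v)" for v
    using inv push by metis+
  have push_Suc': "s i (g' j v) = g' j (g' i (g j (s i v)))" "s j (g' k v) = g' k (g' j (g k (s j v)))" for v
    using inv push_Suc by metis+
  have braid: "s i (s j (s i v)) = s j (s i (s j v))" for v
    using s_braid[OF i2] by (simp add: j_def)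
  have Li: "?L i v = (\<lambda>a. s i (if a = i then g i (v j) else if a = j then v i + v j - g j (v j) else v a))"
    and Lj: "?L j v = (\<lambda>a. s j (if a = j then g j (v k) else if a = k then v j + v k - g k (v k) else v a))"
    if "v \<in> tuples n" for v
    using LM_sigma_apply[OF i that] LM_sigma_apply[OF j that] by (simp_all only: flip: j_def k_def)
  have "?L i \<otimes>\<^bsub>LM_GL scale n\<^esub> (?L j \<otimes>\<^bsub>LM_GL scale n\<^esub> ?L i) =
      ?L j \<otimes>\<^bsub>LM_GL scale n\<^esub> (?L i \<otimes>\<^bsub>LM_GL scale n\<^esub> ?L j)"
  proof (rule GL_on_eqI[of _ "fun_scale scale" "tuples n"])
    fix v :: "nat \<Rightarrow> 'v" assume v: "v \<in> tuples n"
    have V: "?L i v \<in> tuples n" "?L j v \<in> tuples n"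
      "?L j (?L i v) \<in> tuples n" "?L i (?L j v) \<in> tuples n"
      using C v by (auto intro: LM_closed)
    have "?L i (?L j (?L i v)) a = ?L j (?L i (?L j v)) a" for a
      \<comment> \<open>The outermost operator is unfolded first: the facts \<open>V\<close> refer to the unexpanded vectors.\<close>
      unfolding Li[OF V(3)] Lj[OF V(4)]
      unfolding Lj[OF V(1)] Li[OF V(2)]
      unfolding Li[OF v] Lj[OF v]
      using ne by (simp add: push push' push_Suc push_Suc' inv lin braid algebra_simps)
    then show "(?L i \<otimes>\<^bsub>LM_GL scale n\<^esub> (?L j \<otimes>\<^bsub>LM_GL scale n\<^esub> ?L i)) v =
        (?L j \<otimes>\<^bsub>LM_GL scale n\<^esub> (?L i \<otimes>\<^bsub>LM_GL scale n\<^esub> ?L j)) v"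
      using C v V by (simp add: LM_mult_apply fun_eq_iff)
  qed (use C in \<open>auto simp flip: LM_GL_def\<close>)
  then show "?L i \<otimes>\<^bsub>LM_GL scale n\<^esub> (?L (i + 1) \<otimes>\<^bsub>LM_GL scale n\<^esub> ?L i) =
      ?L (i + 1) \<otimes>\<^bsub>LM_GL scale n\<^esub> (?L i \<otimes>\<^bsub>LM_GL scale n\<^esub> ?L (i + 1))"
    by (simp add: j_def)
qed

text \<open>By the universal property, the representation takes the prescribed value at \<open>\<sigma>\<^sub>i\<close>.\<close>

lemma twisted_LM_fb_sigma:
  assumes l: "l \<noteq> 0" and i: "1 \<le> i" "i + 1 \<le> n"
  shows "twisted_LM scale n l \<rho> (fb_sigma n i) = LM_sigma scale n \<rho> i"
proof -
  interpret L: group "LM_GL scale n" by (rule group_LM_GL)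
  have "pres_lift {1..n} {} (LM_GL scale n) (LM_x scale n l \<rho>) \<one>\<^bsub>free_grp n\<^esub> = \<one>\<^bsub>LM_GL scale n\<^esub>"
    by (rule L.pres_lift_one) (auto intro!: LM_x_GL l)
  moreover have "pres_lift {1..n - 1} (braid_rels n) (LM_GL scale n) (LM_sigma scale n \<rho>)
      (braid_gen n i) = LM_sigma scale n \<rho> i"
    using i by (intro L.pres_lift_pres_gen LM_sigma_satisfies_braid_rels) (auto intro!: LM_sigma_GL)
  ultimately show ?thesis
    using LM_sigma_GL[OF i] by (simp add: twisted_LM_def fb_sigma_def)
qed

end

section \<open>Matrices with respect to ordered bases\<close>

text \<open>The rectangular version of \<^const>\<open>matrix_wrt\<close>, with separate bases for source and target: a
  change of basis is then the matrix of the identity, and base change is an instance of composition.\<close>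

definition matrix_between ::
    "('k::field \<Rightarrow> 'v::ab_group_add \<Rightarrow> 'v) \<Rightarrow> 'v list \<Rightarrow> 'v list \<Rightarrow> ('v \<Rightarrow> 'v) \<Rightarrow> 'k mat" where
  "matrix_between scale bs cs f =
    mat (length cs) (length bs)
      (\<lambda>(a, b). Modules.module.representation scale (set cs) (f (bs ! b)) (cs ! a))"

lemma matrix_between_carrier [simp]:
  "matrix_between scale bs cs f \<in> carrier_mat (length cs) (length bs)"
  "dim_row (matrix_between scale bs cs f) = length cs"
  "dim_col (matrix_between scale bs cs f) = length bs"
  by (simp_all add: matrix_between_def)

lemma matrix_wrt_eq_matrix_between: "matrix_wrt scale bs f = matrix_between scale bs bs f"
  by (simp add: matrix_wrt_def matrix_between_def)

context vector_space
begin

lemma sum_set_nth: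
  "distinct bs \<Longrightarrow> (\<Sum>v\<in>set bs. h v) = (\<Sum>a<length bs. h (bs ! a))"
  by (rule sum.reindex_bij_betw[symmetric]) (auto simp: bij_betw_nth)

lemma ordered_basisI:
  assumes mem: "set bs \<subseteq> U" and sub: "subspace U"
    and spanning: "\<And>u. u \<in> U \<Longrightarrow> \<exists>x. u = (\<Sum>a<length bs. scale (x a) (bs ! a))"
    and indep: "\<And>x a. (\<Sum>a<length bs. scale (x a) (bs ! a)) = 0 \<Longrightarrow> a < length bs \<Longrightarrow> x a = 0"
  shows "ordered_basis scale U bs"
proof -
  have dist: "distinct bs"
  proof (rule ccontr)
    assume "\<not> distinct bs"
    then obtain a b where ab: "a < length bs" "b < length bs" "a \<noteq> b" "bs ! a = bs ! b"
      by (auto simp: distinct_conv_nth)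
    \<comment> \<open>A repeated entry gives a nontrivial relation.\<close>
    have "(\<Sum>k<length bs. scale (if k = a then 1 else if k = b then - 1 else 0) (bs ! k)) =
        (\<Sum>k<length bs. (if k = a then bs ! a else 0) - (if k = b then bs ! b else 0))"
      using ab by (intro sum.cong) auto
    also have "\<dots> = 0" using ab by (simp add: sum_subtractf)
    finally show False using indep[OF _ ab(1)] by fastforce
  qed
  have ind: "independent (set bs)"
  proof
    assume "dependent (set bs)"
    then obtain u v where "v \<in> set bs" "u v \<noteq> 0" "(\<Sum>v\<in>set bs. scale (u v) v) = 0"
      by (auto simp: dependent_finite)
    then show False
      using indep[of "\<lambda>a. u (bs ! a)"] dist by (auto simp: sum_set_nth in_set_conv_nth)
  qed
  have "span (set bs) = U"
  proof
    show "span (set bs) \<subseteq> U" using mem sub by (rule span_minimal)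
    show "U \<subseteq> span (set bs)"
    proof
      fix u assume "u \<in> U"
      then obtain x where "u = (\<Sum>a<length bs. scale (x a) (bs ! a))" using spanning by blast
      then show "u \<in> span (set bs)" by (auto intro!: span_sum span_scale simp: span_base)
    qed
  qed
  with dist ind show ?thesis by (simp add: ordered_basis_def)
qed

lemma ordered_basis_expansion:
  assumes "ordered_basis scale U bs" "u \<in> U"
  shows "u = (\<Sum>a<length bs. scale (representation (set bs) u (bs ! a)) (bs ! a))"
  using assms sum_representation_eq[of "set bs" u "set bs"]
  by (simp add: ordered_basis_def sum_set_nth)

lemma ordered_basis_subspace:
  assumes "ordered_basis scale U bs"
  shows "subspace U" "set bs \<subseteq> U"
  using assms by (auto simp: ordered_basis_def span_base)

lemma representation_of_expansion:
  assumes bs: "ordered_basis scale U bs" and a: "a < length bs"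
  shows "representation (set bs) (\<Sum>b<length bs. scale (x b) (bs ! b)) (bs ! a) = x a"
proof -
  have bs': "distinct bs" "independent (set bs)" using bs by (auto simp: ordered_basis_def)
  have "representation (set bs) (\<Sum>b<length bs. scale (x b) (bs ! b)) (bs ! a) =
      (\<Sum>b<length bs. x b * representation (set bs) (bs ! b) (bs ! a))"
    using bs' by (subst representation_sum)
      (auto intro!: sum.cong span_scale simp: representation_scale span_base)
  also have "\<dots> = (\<Sum>b<length bs. if b = a then x a else 0)"
    using bs' a by (intro sum.cong) (auto simp: representation_basis nth_eq_iff_index_eq)
  also have "\<dots> = x a" using a by simp
  finally show ?thesis .
qed

lemma linear_on_sum:
  assumes "linear_on scale U f" "subspace U" "\<And>b. b \<in> B \<Longrightarrow> v b \<in> U"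
  shows "f (\<Sum>b\<in>B. scale (x b) (v b)) = (\<Sum>b\<in>B. scale (x b) (f (v b)))"
proof -
  have f0: "f 0 = 0"
    using assms(1) subspace_0[OF assms(2)] unfolding linear_on_def
    by (metis add_cancel_right_right add_0)
  show ?thesis
    using assms(3)
  proof (induction B rule: infinite_finite_induct)
    case (insert b B)
    then have "(\<Sum>b\<in>B. scale (x b) (v b)) \<in> U" "scale (x b) (v b) \<in> U" "v b \<in> U"
      using assms(2) by (auto intro!: subspace_sum subspace_scale)
    with insert show ?case using assms(1) by (simp add: linear_on_def)
  qed (use f0 in auto)
qed

lemma matrix_between_compose:
  assumes bs: "ordered_basis scale U bs" and cs: "ordered_basis scale V cs"
    and ds: "ordered_basis scale W ds"
    and f: "f ` U \<subseteq> V" and h: "h ` V \<subseteq> W" "linear_on scale V h"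
  shows "matrix_between scale bs ds (\<lambda>v. h (f v)) =
    matrix_between scale cs ds h * matrix_between scale bs cs f"
proof (rule eq_matI)
  fix a b
  assume "a < dim_row (matrix_between scale cs ds h * matrix_between scale bs cs f)"
    and "b < dim_col (matrix_between scale cs ds h * matrix_between scale bs cs f)"
  then have ab: "a < length ds" "b < length bs" by simp_all
  define x where "x = (\<lambda>c. representation (set cs) (f (bs ! b)) (cs ! c))"
  have csV: "\<And>c. c < length cs \<Longrightarrow> cs ! c \<in> V" using ordered_basis_subspace(2)[OF cs] by auto
  have dsW: "independent (set ds)" "span (set ds) = W" using ds by (auto simp: ordered_basis_def)
  have "bs ! b \<in> U" using ordered_basis_subspace(2)[OF bs] ab by auto
  then have "f (bs ! b) = (\<Sum>c<length cs. scale (x c) (cs ! c))"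
    unfolding x_def using ordered_basis_expansion[OF cs] f by auto
  then have "h (f (bs ! b)) = (\<Sum>c<length cs. scale (x c) (h (cs ! c)))"
    using linear_on_sum[OF h(2) ordered_basis_subspace(1)[OF cs], of "{..<length cs}" "\<lambda>c. cs ! c" x]
      csV by simp
  moreover have "h (cs ! c) \<in> span (set ds)" if "c < length cs" for c
    using csV that h(1) dsW by auto
  ultimately have "representation (set ds) (h (f (bs ! b))) (ds ! a) =
      (\<Sum>c<length cs. x c * representation (set ds) (h (cs ! c)) (ds ! a))"
    using dsW(1)
    by (simp only:, subst representation_sum)
      (auto intro!: sum.cong span_scale simp: representation_scale)
  then show "matrix_between scale bs ds (\<lambda>v. h (f v)) $$ (a, b) =
      (matrix_between scale cs ds h * matrix_between scale bs cs f) $$ (a, b)"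
    using ab
    by (simp add: matrix_between_def scalar_prod_def x_def mult.commute lessThan_atLeast0)
qed simp_all

lemma matrix_between_id:
  assumes "ordered_basis scale U bs"
  shows "matrix_between scale bs bs (\<lambda>v. v) = 1\<^sub>m (length bs)"
  using assms
  by (intro eq_matI)
    (auto simp: matrix_between_def ordered_basis_def representation_basis nth_eq_iff_index_eq)

lemma ordered_basis_length:
  assumes "ordered_basis scale U bs" "ordered_basis scale U cs"
  shows "length bs = length cs"
  using assms bij_if_span_eq_span_bases[of "set bs" "set cs"]
  by (auto simp: ordered_basis_def distinct_card[symmetric] dest: bij_betw_same_card)

text \<open>The two matrices are conjugate by the change of basis.\<close>

lemma char_poly_matrix_wrt:
  assumes bs: "ordered_basis scale U bs" and cs: "ordered_basis scale U cs"
    and f: "f ` U \<subseteq> U" "linear_on scale U f"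
  shows "char_poly (matrix_wrt scale bs f) = char_poly (matrix_wrt scale cs f)"
proof (rule char_poly_similar)
  let ?M = "matrix_between scale" and ?id = "\<lambda>v. v"
  have len: "length bs = length cs" by (rule ordered_basis_length[OF bs cs])
  have id: "?id ` U \<subseteq> U" "linear_on scale U ?id" by (auto simp: linear_on_def)
  have "?M cs bs ?id * ?M bs cs ?id = 1\<^sub>m (length bs)"
    using matrix_between_compose[OF bs cs bs id(1) id] matrix_between_id[OF bs] by simp
  moreover have "?M bs cs ?id * ?M cs bs ?id = 1\<^sub>m (length bs)"
    using matrix_between_compose[OF cs bs cs id(1) id] matrix_between_id[OF cs] len by simp
  moreover have "?M bs bs f = ?M cs bs ?id * ?M cs cs f * ?M bs cs ?id"
    using matrix_between_compose[OF bs cs bs id(1) f] matrix_between_compose[OF cs cs bs f(1) id]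
    by simp
  ultimately show "similar_mat (matrix_wrt scale bs f) (matrix_wrt scale cs f)"
    unfolding matrix_wrt_eq_matrix_between using len
    by (intro similar_matI[of _ _ "?M cs bs ?id" "?M bs cs ?id" "length bs"])
      (auto simp: carrier_matI)
qed

end

text \<open>In \<open>z I - A\<close> the two lower blocks \<open>- I\<close> and \<open>z I\<close> commute, so the determinant of the block
  matrix is that of \<open>(z I) (z I) - (- M) (- I)\<close>.\<close>

lemma char_poly_anti_block_diagonal:
  fixes M :: "'k::field mat"
  assumes M: "M \<in> carrier_mat m m"
  shows "char_poly (four_block_mat (0\<^sub>m m m) M (1\<^sub>m m) (0\<^sub>m m m)) = det_sq_minus M"
proof -
  let ?c = "map_mat (\<lambda>a. [:a:])"
  let ?X = "[:0, 1:] \<cdot>\<^sub>m 1\<^sub>m m :: 'k poly mat"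
  have "char_poly_matrix (four_block_mat (0\<^sub>m m m) M (1\<^sub>m m) (0\<^sub>m m m)) =
      four_block_mat ?X (- ?c M) (- 1\<^sub>m m) ?X"
    using M by (intro eq_matI) (auto simp: char_poly_matrix_def one_pCons)
  also have "det \<dots> = det (?X * ?X - (- ?c M) * (- 1\<^sub>m m))"
    using M by (intro det_four_block_mat) auto
  also have "?X * ?X - (- ?c M) * (- 1\<^sub>m m) = monom 1 2 \<cdot>\<^sub>m 1\<^sub>m (dim_row M) - ?c M"
    using M by (auto simp: monom_altdef power2_eq_square)
  finally show ?thesis by (simp add: char_poly_def det_sq_minus_def)
qed

lemma vector_space_pair_scale:
  "vector_space scale \<Longrightarrow> vector_space (pair_scale scale)"
  unfolding vector_space_def pair_scale_def by simp

lemma fst_snd_sum_pair_scale: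
  "fst (\<Sum>a\<in>A. pair_scale scale (x a) (p a)) = (\<Sum>a\<in>A. scale (x a) (fst (p a)))"
  "snd (\<Sum>a\<in>A. pair_scale scale (x a) (p a)) = (\<Sum>a\<in>A. scale (x a) (snd (p a)))"
  by (simp_all add: fst_sum snd_sum pair_scale_def)

lemma sum_lessThan_add:
  fixes F :: "nat \<Rightarrow> 'a::comm_monoid_add"
  shows "(\<Sum>a<m + k. F a) = (\<Sum>a<m. F a) + (\<Sum>a<k. F (m + a))"
  by (induction k) (auto simp: ac_simps)

text \<open>The isomorphism \<open>f\<close> transports the basis \<open>c\<^sub>1, ..., c\<^sub>m\<close> of \<open>U\<close> to \<open>V\<close>. In the resulting basis
  \<open>(c\<^sub>a, 0), (0, f c\<^sub>a)\<close> of the product, the component \<open>f\<close> becomes the identity matrix and the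
  component \<open>h\<close> becomes the matrix of \<open>h \<circ> f\<close>.\<close>

lemma (in vector_space) char_poly_anti_diagonal_operator:
  assumes bs: "ordered_basis (pair_scale scale) (U \<times> V) bs"
    and cs: "ordered_basis scale U cs"
    and f: "bij_betw f U V" "linear_on scale U f"
    and h: "h ` V \<subseteq> U" "linear_on scale V h"
  shows "char_poly (matrix_wrt (pair_scale scale) bs (\<lambda>(u, v). (h v, f u))) =
    det_sq_minus (matrix_wrt scale cs (\<lambda>u. h (f u)))"
proof -
  interpret PS: vector_space "pair_scale scale"
    by (rule vector_space_pair_scale) (rule vector_space_axioms)
  let ?P = "\<lambda>(u, v). (h v, f u)"
  define m where "m = length cs"
  define M where "M = matrix_wrt scale cs (\<lambda>u. h (f u))"
  define ds where "ds = map (\<lambda>c. (c, 0)) cs @ map (\<lambda>c. (0, f c)) cs"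
  have U: "subspace U" and cU: "\<And>a. a < m \<Longrightarrow> cs ! a \<in> U"
    using ordered_basis_subspace[OF cs] by (auto simp: m_def)
  have fU: "f u \<in> V" if "u \<in> U" for u using f(1) that by (auto simp: bij_betw_def)
  have sumU: "(\<Sum>a<m. scale (x a) (cs ! a)) \<in> U" for x
    using U cU by (auto intro!: subspace_sum subspace_scale)
  have f_sum: "f (\<Sum>a<m. scale (x a) (cs ! a)) = (\<Sum>a<m. scale (x a) (f (cs ! a)))" for x
    using linear_on_sum[OF f(2) U, of "{..<m}" "\<lambda>a. cs ! a" x] cU by simp
  have f0: "f 0 = 0" using f_sum[of "\<lambda>_. 0"] by simp
  have V: "subspace V"
  proof (rule subspaceI)
    have onto: "\<exists>u\<in>U. v = f u" if "v \<in> V" for v using f(1) that by (auto simp: bij_betw_def)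
    show "0 \<in> V" using fU[OF subspace_0[OF U]] f0 by simp
    fix v w assume "v \<in> V" "w \<in> V"
    then obtain u u' where u: "u \<in> U" "v = f u" "u' \<in> U" "w = f u'" using onto by blast
    then have "v + w = f (u + u')" using f(2) by (simp add: linear_on_def)
    then show "v + w \<in> V" using fU subspace_add[OF U] u by auto
    fix c
    have "scale c v = f (scale c u)" using f(2) u by (simp add: linear_on_def)
    then show "scale c v \<in> V" using fU subspace_scale[OF U] u by auto
  qed
  have h0: "h 0 = 0" using linear_on_sum[OF h(2) V, of "{}"] by simp
  have len: "length ds = m + m" by (simp add: ds_def m_def)
  have nth: "ds ! a = (if a < m then (cs ! a, 0) else (0, f (cs ! (a - m))))" if "a < m + m" for a
    using that by (auto simp: ds_def m_def nth_append)
  have expand: "(\<Sum>a<length ds. pair_scale scale (x a) (ds ! a)) =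
      ((\<Sum>a<m. scale (x a) (cs ! a)), (\<Sum>a<m. scale (x (m + a)) (f (cs ! a))))" for x
    unfolding len sum_lessThan_add
    by (intro prod_eqI) (simp_all add: fst_snd_sum_pair_scale nth)
  have ds: "ordered_basis (pair_scale scale) (U \<times> V) ds"
  proof (rule PS.ordered_basisI)
    show "set ds \<subseteq> U \<times> V"
      using ordered_basis_subspace[OF cs] subspace_0[OF U] subspace_0[OF V] fU
      by (auto simp: ds_def)
    show "PS.subspace (U \<times> V)"
      using U V by (auto simp: PS.subspace_def subspace_def pair_scale_def zero_prod_def)
  next
    fix p assume "p \<in> U \<times> V"
    then obtain u u' where u: "u \<in> U" "u' \<in> U" "p = (u, f u')"
      using f(1) by (auto simp: bij_betw_def)
    let ?x = "\<lambda>a. if a < m then representation (set cs) u (cs ! a)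
      else representation (set cs) u' (cs ! (a - m))"
    have "f u' = (\<Sum>a<m. scale (representation (set cs) u' (cs ! a)) (f (cs ! a)))"
      using arg_cong[where f = f, OF ordered_basis_expansion[OF cs u(2)]] by (simp only: f_sum flip: m_def)
    moreover have "u = (\<Sum>a<m. scale (representation (set cs) u (cs ! a)) (cs ! a))"
      using ordered_basis_expansion[OF cs u(1)] by (simp add: m_def)
    ultimately have "p = (\<Sum>a<length ds. pair_scale scale (?x a) (ds ! a))"
      unfolding expand u(3) by simp
    then show "\<exists>x. p = (\<Sum>a<length ds. pair_scale scale (x a) (ds ! a))" by (rule exI[of _ ?x])
  next
    fix x a
    assume "(\<Sum>a<length ds. pair_scale scale (x a) (ds ! a)) = 0" and a: "a < length ds"
    then have 1: "(\<Sum>a<m. scale (x a) (cs ! a)) = 0"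
      and "f (\<Sum>a<m. scale (x (m + a)) (cs ! a)) = 0"
      by (simp_all add: expand zero_prod_def f_sum)
    then have 2: "(\<Sum>a<m. scale (x (m + a)) (cs ! a)) = 0"
      using inj_onD[OF bij_betw_imp_inj_on[OF f(1)] _ sumU subspace_0[OF U]] f0 by simp
    have zero: "y a = 0" if "(\<Sum>a<m. scale (y a) (cs ! a)) = 0" "a < m" for y a
      using representation_of_expansion[OF cs, of a y] that by (simp add: m_def representation_zero)
    show "x a = 0"
      using zero[OF 1, of a] zero[OF 2, of "a - m"] a by (cases "a < m") (auto simp: len)
  qed
  \<comment> \<open>Column \<open>b\<close> of the matrix of the operator in the basis \<open>ds\<close>.\<close>
  define y where "y = (\<lambda>b c. if b < m then (if c = m + b then 1 else 0)
    else if c < m then M $$ (c, b - m) else 0)"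
  have P_nth: "?P (ds ! b) = (\<Sum>c<length ds. pair_scale scale (y b c) (ds ! c))" if "b < m + m" for b
  proof (cases "b < m")
    case True
    have "(\<Sum>a<m. scale (y b (m + a)) (f (cs ! a))) = (\<Sum>a<m. if a = b then f (cs ! a) else 0)"
      using True by (intro sum.cong) (auto simp: y_def)
    then show ?thesis
      unfolding expand using True that h0 by (simp add: nth y_def)
  next
    case False
    then have b: "b - m < m" using that by auto
    have "h (f (cs ! (b - m))) \<in> U" using fU cU[OF b] h(1) by auto
    from ordered_basis_expansion[OF cs this]
    have "h (f (cs ! (b - m))) = (\<Sum>a<m. scale (y b a) (cs ! a))"
      using False b by (simp add: y_def M_def matrix_wrt_def m_def)
    then show ?thesis
      unfolding expand using False that f0 by (simp add: nth y_def)
  qed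
  have M: "M \<in> carrier_mat m m" by (simp add: M_def matrix_wrt_def m_def)
  have "matrix_wrt (pair_scale scale) ds ?P = four_block_mat (0\<^sub>m m m) M (1\<^sub>m m) (0\<^sub>m m m)"
  proof (rule eq_matI)
    fix a b
    assume "a < dim_row (four_block_mat (0\<^sub>m m m) M (1\<^sub>m m) (0\<^sub>m m m))"
      and "b < dim_col (four_block_mat (0\<^sub>m m m) M (1\<^sub>m m) (0\<^sub>m m m))"
    then have ab: "a < m + m" "b < m + m" using M by auto
    then have "matrix_wrt (pair_scale scale) ds ?P $$ (a, b) = y b a"
      using PS.representation_of_expansion[OF ds, of a "y b"] P_nth[OF ab(2)]
      by (simp add: matrix_wrt_def len)
    then show "matrix_wrt (pair_scale scale) ds ?P $$ (a, b) =
        four_block_mat (0\<^sub>m m m) M (1\<^sub>m m) (0\<^sub>m m m) $$ (a, b)"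
      using ab M by (auto simp: y_def)
  qed (use M in \<open>simp_all add: matrix_wrt_def len\<close>)
  moreover have "?P ` (U \<times> V) \<subseteq> U \<times> V" using h(1) fU by auto
  moreover have "linear_on (pair_scale scale) (U \<times> V) ?P"
    using f(2) h(2) by (auto simp: linear_on_def pair_scale_def)
  ultimately show ?thesis
    using PS.char_poly_matrix_wrt[OF bs ds] char_poly_anti_block_diagonal[OF M] by (simp add: M_def)
qed

theorem lemma5p3:
  fixes scale :: "'k::field \<Rightarrow> 'v::ab_group_add \<Rightarrow> 'v"
    and Basis :: "'v set"
    and \<rho> :: "free_braid_elt \<Rightarrow> 'v \<Rightarrow> 'v"
    and l :: 'k
    and n N i :: nat
  assumes "finite_dimensional_vector_space scale Basis"
    and "vector_space.dim scale (UNIV :: 'v set) = N"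
    and "n \<ge> 2"
    and "\<rho> \<in> hom (free_braid_grp n) (GL_on scale UNIV)"
    and "l \<noteq> 0" and "l \<noteq> 1"
    and "1 \<le> i" and "i \<le> n - 1"
  shows
    "let g = (\<lambda>j. \<rho> (fb_x n j));
         s = \<rho> (fb_sigma n i);
         S = twisted_LM scale n l \<rho> (fb_sigma n i);
         W = (\<lambda>j. {v. g j v - v = 0});
         K = dsum n W;
         P = (\<lambda>(u, v). (s (g i v), s u))
     in
       (\<forall>k\<in>{1..n} - {i, i + 1}. s ` W k \<subseteq> W k) \<and>
       linear_on scale (W i) s \<and> bij_betw s (W i) (W (i + 1)) \<and>
       (\<lambda>v. s (g i v)) ` W (i + 1) \<subseteq> W i \<and>
       (\<forall>w\<in>K. S w \<in> K \<and>
          (\<forall>k\<in>{1..n} - {i, i + 1}. S w k = s (w k)) \<and>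
          (S w i, S w (i + 1)) = P (w i, w (i + 1))) \<and>
       P ` (W i \<times> W (i + 1)) \<subseteq> W i \<times> W (i + 1) \<and>
       (\<lambda>v. s (g i (s v))) ` W i \<subseteq> W i \<and>
       (\<forall>bs cs. ordered_basis (pair_scale scale) (W i \<times> W (i + 1)) bs \<longrightarrow>
          ordered_basis scale (W i) cs \<longrightarrow>
          char_poly (matrix_wrt (pair_scale scale) bs P) =
          det_sq_minus (matrix_wrt scale cs (\<lambda>v. s (g i (s v)))))"
proof -
  interpret finite_dimensional_vector_space scale Basis by fact
  interpret free_braid_rep scale n \<rho> by unfold_locales fact
  have i: "1 \<le> i" "i + 1 \<le> n" using assms by auto
  have i': "i \<le> n" using i by simp
  define W where "W = (\<lambda>j. {v. g j v - v = 0})"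
  have W: "v \<in> W j \<longleftrightarrow> g j v = v" for v j by (simp add: W_def)
  have sW: "s i v \<in> W k" if "v \<in> W k" "k \<in> {1..n} - {i, i + 1}" for v k
    using that s_g_other[OF i, of k v] by (simp add: W)
  have sWi: "s i v \<in> W (i + 1) \<longleftrightarrow> v \<in> W i" for v
    using s_g_self[OF i, of v] s_simps(5)[OF i] by (metis W)
  have bij: "bij_betw (s i) (W i) (W (i + 1))"
    unfolding bij_betw_def
  proof
    show "inj_on (s i) (W i)" using s_simps(5)[OF i] by (auto intro: inj_onI)
    show "s i ` W i = W (i + 1)"
    proof
      show "W (i + 1) \<subseteq> s i ` W i"
        using s_simps(6)[OF i] sWi by (metis imageI subsetI)
    qed (use sWi in auto)
  qed
  \<comment> \<open>Here \<open>s\<^sub>i g\<^sub>i v = g\<^bsub>i+1\<^esub> s\<^sub>i v\<close>, and \<open>g\<^sub>i\<close> sends this to \<open>g\<^bsub>i+1\<^esub> s\<^sub>i g\<^bsub>i+1\<^esub> v\<close>.\<close>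
  have sgW: "s i (g i v) \<in> W i" if v: "v \<in> W (i + 1)" for v
    using that s_g_Suc[OF i, of v] s_g_self[OF i, of v] by (simp add: W)
  have lin_s: "linear_on scale U (s i)" for U
    using s_simps[OF i] by (simp add: linear_on_def)
  have lin_sg: "linear_on scale U (\<lambda>v. s i (g i v))" for U
    using s_simps[OF i] g_simps[OF i(1) i'] by (simp add: linear_on_def)
  define S where "S = twisted_LM scale n l \<rho> (fb_sigma n i)"
  have S: "S w = (\<lambda>a. s i (if a = i then g i (w (i + 1)) else if a = i + 1 then w i else w a))"
    if "w \<in> dsum n W" for w
  proof -
    have "w \<in> tuples n" "w (i + 1) \<in> W (i + 1)" using that i by (auto simp: dsum_def)
    then show ?thesis
      using twisted_LM_fb_sigma[OF assms(5) i] LM_sigma_apply[OF i, of w]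
      by (auto simp: S_def W)
  qed
  have SK: "S w \<in> dsum n W" if w: "w \<in> dsum n W" for w
  proof -
    have wW: "w a \<in> W a" if "a \<in> {1..n}" for a using w that by (auto simp: dsum_def)
    have w0: "w a = 0" if "a \<notin> {1..n}" for a using w that by (auto simp: dsum_def)
    have "S w a \<in> W a" if "a \<in> {1..n}" for a
      unfolding S[OF w] using that sW[of "w a" a] sWi[of "w i"] sgW[of "w (i + 1)"] wW[of i] wW[of "i + 1"]
        wW[of a] i by auto
    moreover have "S w a = 0" if "a \<notin> {1..n}" for a
      unfolding S[OF w] using that w0 i s_simps(3)[OF i] by auto
    ultimately show ?thesis by (simp add: dsum_def)
  qed
  have poly: "char_poly (matrix_wrt (pair_scale scale) bs (\<lambda>(u, v). (s i (g i v), s i u))) =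
      det_sq_minus (matrix_wrt scale cs (\<lambda>v. s i (g i (s i v))))"
    if "ordered_basis (pair_scale scale) (W i \<times> W (i + 1)) bs" "ordered_basis scale (W i) cs" for bs cs
    by (rule char_poly_anti_diagonal_operator[OF that bij lin_s _ lin_sg]) (use sgW in auto)
  have fold_W: "{v. g j v - v = 0} = W j" for j by (simp add: W_def)
  show ?thesis
    unfolding Let_def g_def[symmetric] s_def[symmetric] S_def[symmetric] fold_W
  proof (intro conjI ballI allI impI)
    show "linear_on scale (W i) (s i)" by (rule lin_s)
    show "bij_betw (s i) (W i) (W (i + 1))" by (rule bij)
    show "S w \<in> dsum n W" if "w \<in> dsum n W" for w using that by (rule SK)
  qed (use sW sgW sWi S poly in auto)
qed

end
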